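(* Let $Q$ be a quiver and $\alpha\colon Q\to Q$ be a quiver morphism. Let $(\mathbf{k}Q,\mu,\Delta)$ be the path $\epsilon$-bialgebra of $Q$ and let $\alpha_*\colon\mathbf{k}Q\to\mathbf{k}Q$ be the $\epsilon$-bialgebra morphism induced by $\alpha$. Then $$\mathbf{k}Q_{\alpha_*}=(\mathbf{k}Q,\mu_{\alpha_*},\Delta_{\alpha_*},\alpha_* )$$ is an $\epsilon$-Hom-bialgebra, where $\mu_{\alpha_*}=\alpha_*\circ\mu$ and $\Delta_{\alpha_*}=\Delta\circ\alpha_*$.
   Context: Throughout, $\mathbf{k}$ is a fixed field of characteristic $0$; vector spaces, linear maps and tensor products are over $\mathbf{k}$. Algebras are not required to be unital. An $\epsilon$-Hom-bialgebra $(A,\mu,\Delta,\alpha)$ is a $\mathbf{k}$-vector space $A$ with linear maps $\mu\colon A^{\otimes 2}\to A$, $\Delta\colon A\to A^{\otimes 2}$, $\alpha\colon A\to A$ such that: $\alpha\circ\mu=\mu\circ\alpha^{\otimes 2}$; $\mu\circ(\alpha\otimes\mu)=\mu\circ(\mu\otimes\alpha)$; $\alpha^{\otimes 2}\circ\Delta=\Delta\circ\alpha$; $(\alpha\otimes\Delta)\circ\Delta=(\Delta\otimes\alpha)\circ\Delta$; and $\Delta\circ\mu=(\mu\otimes\alpha)\circ(\alpha\otimes\Delta)+(\alpha\otimes\mu)\circ(\Delta\otimes\alpha)$. An $\epsilon$-bialgebra is an $\epsilon$-Hom-bialgebra with $\alpha=Id$; a morphism of $\epsilon$-bialgebras is a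 linear map commuting with multiplications and comultiplications. A quiver $Q=(Q_0,Q_1,s,t)$ consists of a set $Q_0$ of vertices, a set $Q_1$ of arrows, and maps $s,t\colon Q_1\to Q_0$ (source and target). A path of length $l\ge 1$ is an $l$-tuple $\phi_1\cdots\phi_l$ of arrows with $t(\phi_i)=s(\phi_{i+1})$ for $1\le i\le l-1$; its source is $s(\phi_1)$ and its target is $t(\phi_l)$. A path of length $0$ is a vertex (with itself as source and target). $Q_l$ denotes the set of paths of length $l$. The path algebra $\mathbf{k}Q=\bigoplus_{l\ge 0}\mathbf{k}Q_l$ has basis $\bigcup_{l\ge 0}Q_l$, with multiplication $\mu$ determined on paths by concatenation: the product $pq$ of two paths is the concatenated path if the target of $p$ equals the source of $q$, and is $0$ otherwise. The path $\epsilon$-bialgebra of $Q$ is $\mathbf{k}Q$ with this multiplication and the comultiplication determined by $\Delta(v)=0$ for $v\in Q_0$; $\Delta(\phi)=s(\phi)\otimes t(\phi)$ for $\phi\in Q_1$; and for $\phi_1\cdots\phi_l\in Q_l$ with $l\ge 2$, $$\Delta(\phi_1\cdots\phi_l)=s(\phi_1)\otimes\phi_2\cdots\phi_l+\phi_1\cdots\phi_{l-1}\otimes t(\phi_l)+\sum_{i=1}^{l-2}\phi_1\cdots\phi_i\otimes\phi_{i+2}\cdots\phi_l.$$ A quiver morphism $\alpha\colon Q\to Q'$ consists of maps $\alpha_i\colon Q_i\to Q_i'$ ($i=0,1$), both written $\alpha$, such that $s(\alpha_1(\phi))=\alpha_0(s(\phi))$ and $t(\alpha_1(\phi))=\alpha_0(t(\phi))$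 for all $\phi\in Q_1$, and such that $\alpha_0$ is injective. The induced $\epsilon$-bialgebra morphism $\alpha_*\colon\mathbf{k}Q\to\mathbf{k}Q'$ is the linear map with $\alpha_*|_{Q_i}=\alpha$ for $i=0,1$ and $\alpha_*(\phi_1\cdots\phi_l)=\alpha(\phi_1)\cdots\alpha(\phi_l)$ for $l\ge 2$ and $\phi_1\cdots\phi_l\in Q_l$. *)

theory Defs
  imports "HOL-Library.Poly_Mapping" "Graph_Theory.Digraph"
begin

section \<open>Vector spaces and tensor products\<close>

text \<open>
  A vector space is a linear subspace \<open>vec V\<close> of an ambient type on which \<open>scl V\<close> acts.
  Spaces are not identified with whole types because the path algebra of a quiver
  depends on the quiver, which is a term. Linear maps are therefore only meaningful on
  \<open>vec V\<close>, and two of them are considered equal if they agree there.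
\<close>

record ('k, 'a) vspace =
  vec :: "'a set"
  scl :: "'k \<Rightarrow> 'a \<Rightarrow> 'a"

definition is_vspace :: "('k::field, 'a::ab_group_add) vspace \<Rightarrow> bool" where
  "is_vspace V \<longleftrightarrow> vector_space (scl V) \<and> module.subspace (scl V) (vec V)"

definition linear_map ::
  "('k::field, 'a::ab_group_add) vspace \<Rightarrow> ('k, 'b::ab_group_add) vspace \<Rightarrow> ('a \<Rightarrow> 'b) \<Rightarrow> bool" where
  "linear_map V W f \<longleftrightarrow>
     (\<forall>x\<in>vec V. f x \<in> vec W) \<and>
     (\<forall>x\<in>vec V. \<forall>y\<in>vec V. f (x + y) = f x + f y) \<and>
     (\<forall>c. \<forall>x\<in>vec V. f (scl V c x) = scl W c (f x))"

definition free_space :: "'x set \<Rightarrow> ('k::field, 'x \<Rightarrow>\<^sub>0 'k) vspace" where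
  "free_space X = \<lparr>vec = {x. Poly_Mapping.keys x \<subseteq> X}, scl = (\<lambda>c. Poly_Mapping.map ((*) c))\<rparr>"

abbreviation basis_vec :: "'x \<Rightarrow> 'x \<Rightarrow>\<^sub>0 'k::field" where
  "basis_vec p \<equiv> Poly_Mapping.single p 1"

definition linear_extension ::
  "('k::field, 'a::ab_group_add) vspace \<Rightarrow> ('x \<Rightarrow> 'a) \<Rightarrow> ('x \<Rightarrow>\<^sub>0 'k) \<Rightarrow> 'a" where
  "linear_extension V f x = (\<Sum>p\<in>Poly_Mapping.keys x. scl V (Poly_Mapping.lookup x p) (f p))"

definition bilinear_relations ::
  "('k::field, 'a::ab_group_add) vspace \<Rightarrow> ('k, 'b::ab_group_add) vspace \<Rightarrow> ('a \<times> 'b \<Rightarrow>\<^sub>0 'k) set" where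
  "bilinear_relations V W =
     {basis_vec (a + a', b) - basis_vec (a, b) - basis_vec (a', b) |a a' b.
        a \<in> vec V \<and> a' \<in> vec V \<and> b \<in> vec W} \<union>
     {basis_vec (a, b + b') - basis_vec (a, b) - basis_vec (a, b') |a b b'.
        a \<in> vec V \<and> b \<in> vec W \<and> b' \<in> vec W} \<union>
     {basis_vec (scl V c a, b) - Poly_Mapping.single (a, b) c |c a b.
        a \<in> vec V \<and> b \<in> vec W} \<union>
     {basis_vec (a, scl W c b) - Poly_Mapping.single (a, b) c |c a b.
        a \<in> vec V \<and> b \<in> vec W}"

text \<open>
  \<open>T\<close> with \<open>a \<otimes> b = t a b\<close> is a tensor product of \<open>V\<close> and \<open>W\<close>: the linear map from the free
  vector space on \<open>vec V \<times> vec W\<close> to \<open>T\<close> with \<open>(a, b) \<mapsto> t a b\<close> identifies \<open>T\<close> with the usual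
  quotient by the bilinearity relations.
\<close>

definition tensor_product ::
  "('k::field, 'a::ab_group_add) vspace \<Rightarrow> ('k, 'b::ab_group_add) vspace \<Rightarrow>
   ('k, 't::ab_group_add) vspace \<Rightarrow> ('a \<Rightarrow> 'b \<Rightarrow> 't) \<Rightarrow> bool" where
  "tensor_product V W T t \<longleftrightarrow>
     is_vspace V \<and> is_vspace W \<and> is_vspace T \<and>
     (let F = free_space (vec V \<times> vec W); \<pi> = linear_extension T (\<lambda>(a, b). t a b) in
        \<pi> ` vec F = vec T \<and>
        {x \<in> vec F. \<pi> x = 0} = module.span (scl F) (bilinear_relations V W))"

text \<open>
  \<open>f \<otimes> g : V \<otimes> W \<rightarrow> V' \<otimes> W'\<close>, where \<open>V \<otimes> W\<close> is \<open>(T, t)\<close> and \<open>V' \<otimes> W'\<close> is \<open>(T', t')\<close>.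
  For linear \<open>f\<close> and \<open>g\<close> the map exists and is unique on \<open>vec T\<close>.
\<close>

definition tensor_map ::
  "('k::field, 'a::ab_group_add) vspace \<Rightarrow> ('k, 'b::ab_group_add) vspace \<Rightarrow>
   ('k, 't::ab_group_add) vspace \<Rightarrow> ('a \<Rightarrow> 'b \<Rightarrow> 't) \<Rightarrow>
   ('k, 't1::ab_group_add) vspace \<Rightarrow> ('a1 \<Rightarrow> 'b1 \<Rightarrow> 't1) \<Rightarrow>
   ('a \<Rightarrow> 'a1) \<Rightarrow> ('b \<Rightarrow> 'b1) \<Rightarrow> 't \<Rightarrow> 't1" where
  "tensor_map V W T t T' t' f g =
     (SOME h. linear_map T T' h \<and> (\<forall>a\<in>vec V. \<forall>b\<in>vec W. h (t a b) = t' (f a) (g b)))"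


section \<open>Hom-bialgebras\<close>

text \<open>
  \<open>A3\<close> is the tensor cube, both as \<open>(A \<otimes> A) \<otimes> A\<close> via \<open>tensl\<close> and as \<open>A \<otimes> (A \<otimes> A)\<close> via \<open>tensr\<close>;
  the last assumption makes the two structures agree along the associativity isomorphism.
\<close>

locale tensor_powers =
  fixes A :: "('k::field, 'a::ab_group_add) vspace"
    and A2 :: "('k, 'a2::ab_group_add) vspace" and tens :: "'a \<Rightarrow> 'a \<Rightarrow> 'a2"
    and A3 :: "('k, 'a3::ab_group_add) vspace"
    and tensl :: "'a2 \<Rightarrow> 'a \<Rightarrow> 'a3" and tensr :: "'a \<Rightarrow> 'a2 \<Rightarrow> 'a3"
  assumes square: "tensor_product A A A2 tens"
    and cube_left: "tensor_product A2 A A3 tensl"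
    and cube_right: "tensor_product A A2 A3 tensr"
    and cube_assoc: "\<And>a b c. a \<in> vec A \<Longrightarrow> b \<in> vec A \<Longrightarrow> c \<in> vec A \<Longrightarrow>
      tensl (tens a b) c = tensr a (tens b c)"
begin

definition map_1_1 :: "('a \<Rightarrow> 'a) \<Rightarrow> ('a \<Rightarrow> 'a) \<Rightarrow> 'a2 \<Rightarrow> 'a2" where
  "map_1_1 = tensor_map A A A2 tens A2 tens"

definition map_1_mult :: "('a \<Rightarrow> 'a) \<Rightarrow> ('a2 \<Rightarrow> 'a) \<Rightarrow> 'a3 \<Rightarrow> 'a2" where
  "map_1_mult = tensor_map A A2 A3 tensr A2 tens"

definition map_mult_1 :: "('a2 \<Rightarrow> 'a) \<Rightarrow> ('a \<Rightarrow> 'a) \<Rightarrow> 'a3 \<Rightarrow> 'a2" where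
  "map_mult_1 = tensor_map A2 A A3 tensl A2 tens"

definition map_1_comult :: "('a \<Rightarrow> 'a) \<Rightarrow> ('a \<Rightarrow> 'a2) \<Rightarrow> 'a2 \<Rightarrow> 'a3" where
  "map_1_comult = tensor_map A A A2 tens A3 tensr"

definition map_comult_1 :: "('a \<Rightarrow> 'a2) \<Rightarrow> ('a \<Rightarrow> 'a) \<Rightarrow> 'a2 \<Rightarrow> 'a3" where
  "map_comult_1 = tensor_map A A A2 tens A3 tensl"

end

locale eps_hom_bialgebra = tensor_powers A A2 tens A3 tensl tensr
  for A :: "('k::field, 'a::ab_group_add) vspace"
    and A2 :: "('k, 'a2::ab_group_add) vspace" and tens :: "'a \<Rightarrow> 'a \<Rightarrow> 'a2"
    and A3 :: "('k, 'a3::ab_group_add) vspace"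
    and tensl :: "'a2 \<Rightarrow> 'a \<Rightarrow> 'a3" and tensr :: "'a \<Rightarrow> 'a2 \<Rightarrow> 'a3" +
  fixes \<mu> :: "'a2 \<Rightarrow> 'a" and \<Delta> :: "'a \<Rightarrow> 'a2" and \<alpha> :: "'a \<Rightarrow> 'a"
  assumes mult_linear: "linear_map A2 A \<mu>"
    and comult_linear: "linear_map A A2 \<Delta>"
    and twist_linear: "linear_map A A \<alpha>"
    and mult_twist: "\<And>x. x \<in> vec A2 \<Longrightarrow> (\<alpha> \<circ> \<mu>) x = (\<mu> \<circ> map_1_1 \<alpha> \<alpha>) x"
    and hom_assoc: "\<And>x. x \<in> vec A3 \<Longrightarrow> (\<mu> \<circ> map_1_mult \<alpha> \<mu>) x = (\<mu> \<circ> map_mult_1 \<mu> \<alpha>) x"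
    and comult_twist: "\<And>x. x \<in> vec A \<Longrightarrow> (map_1_1 \<alpha> \<alpha> \<circ> \<Delta>) x = (\<Delta> \<circ> \<alpha>) x"
    and hom_coassoc: "\<And>x. x \<in> vec A \<Longrightarrow>
      (map_1_comult \<alpha> \<Delta> \<circ> \<Delta>) x = (map_comult_1 \<Delta> \<alpha> \<circ> \<Delta>) x"
    and derivation: "\<And>x. x \<in> vec A2 \<Longrightarrow>
      (\<Delta> \<circ> \<mu>) x = (map_mult_1 \<mu> \<alpha> \<circ> map_1_comult \<alpha> \<Delta>) x + (map_1_mult \<alpha> \<mu> \<circ> map_comult_1 \<Delta> \<alpha>) x"


section \<open>Path bialgebras of quivers\<close>

text \<open>
  A quiver is a \<^locale>\<open>wf_digraph\<close>: \<open>verts\<close> and \<open>arcs\<close> are arbitrary sets, and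
  \<open>tail\<close> and \<open>head\<close> are the source and the target of an arrow.
\<close>

definition quiver_morphism ::
  "('v, 'e) pre_digraph \<Rightarrow> ('w, 'f) pre_digraph \<Rightarrow> ('v \<Rightarrow> 'w) \<Rightarrow> ('e \<Rightarrow> 'f) \<Rightarrow> bool" where
  "quiver_morphism Q Q' \<alpha>0 \<alpha>1 \<longleftrightarrow>
     \<alpha>0 ` verts Q \<subseteq> verts Q' \<and> \<alpha>1 ` arcs Q \<subseteq> arcs Q' \<and>
     (\<forall>e\<in>arcs Q. tail Q' (\<alpha>1 e) = \<alpha>0 (tail Q e) \<and> head Q' (\<alpha>1 e) = \<alpha>0 (head Q e)) \<and>
     inj_on \<alpha>0 (verts Q)"

datatype ('v, 'e) qpath = Vertex 'v | Arrows "'e list"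

definition paths :: "('v, 'e) pre_digraph \<Rightarrow> ('v, 'e) qpath set" where
  "paths Q = Vertex ` verts Q \<union>
     Arrows ` {es. es \<noteq> [] \<and> set es \<subseteq> arcs Q \<and> successively (\<lambda>e f. head Q e = tail Q f) es}"

fun source :: "('v, 'e) pre_digraph \<Rightarrow> ('v, 'e) qpath \<Rightarrow> 'v" where
  "source Q (Vertex v) = v"
| "source Q (Arrows es) = tail Q (hd es)"

fun target :: "('v, 'e) pre_digraph \<Rightarrow> ('v, 'e) qpath \<Rightarrow> 'v" where
  "target Q (Vertex v) = v"
| "target Q (Arrows es) = head Q (last es)"

fun concat_path :: "('v, 'e) qpath \<Rightarrow> ('v, 'e) qpath \<Rightarrow> ('v, 'e) qpath" where
  "concat_path (Vertex v) q = q"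
| "concat_path p (Vertex v) = p"
| "concat_path (Arrows es) (Arrows fs) = Arrows (es @ fs)"

definition free_tensor ::
  "('x \<Rightarrow>\<^sub>0 'k::field) \<Rightarrow> ('y \<Rightarrow>\<^sub>0 'k) \<Rightarrow> ('x \<times> 'y \<Rightarrow>\<^sub>0 'k)" where
  "free_tensor x y = (\<Sum>p\<in>Poly_Mapping.keys x. \<Sum>q\<in>Poly_Mapping.keys y.
     Poly_Mapping.single (p, q) (Poly_Mapping.lookup x p * Poly_Mapping.lookup y q))"

definition free_tensor_left ::
  "('x \<times> 'y \<Rightarrow>\<^sub>0 'k::field) \<Rightarrow> ('z \<Rightarrow>\<^sub>0 'k) \<Rightarrow> ('x \<times> 'y \<times> 'z \<Rightarrow>\<^sub>0 'k)" where
  "free_tensor_left x z =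
     linear_extension (free_space UNIV) (\<lambda>((p, q), r). basis_vec (p, q, r)) (free_tensor x z)"

abbreviation path_space ::
  "('v, 'e) pre_digraph \<Rightarrow> ('k::field, ('v, 'e) qpath \<Rightarrow>\<^sub>0 'k) vspace" where
  "path_space Q \<equiv> free_space (paths Q)"

abbreviation path_space2 ::
  "('v, 'e) pre_digraph \<Rightarrow> ('k::field, ('v, 'e) qpath \<times> ('v, 'e) qpath \<Rightarrow>\<^sub>0 'k) vspace" where
  "path_space2 Q \<equiv> free_space (paths Q \<times> paths Q)"

abbreviation path_space3 ::
  "('v, 'e) pre_digraph \<Rightarrow>
   ('k::field, ('v, 'e) qpath \<times> ('v, 'e) qpath \<times> ('v, 'e) qpath \<Rightarrow>\<^sub>0 'k) vspace" where
  "path_space3 Q \<equiv> free_space (paths Q \<times> paths Q \<times> paths Q)"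

definition path_mult ::
  "('v, 'e) pre_digraph \<Rightarrow> (('v, 'e) qpath \<times> ('v, 'e) qpath \<Rightarrow>\<^sub>0 'k::field) \<Rightarrow> (('v, 'e) qpath \<Rightarrow>\<^sub>0 'k)" where
  "path_mult Q = linear_extension (path_space Q)
     (\<lambda>(p, q). if target Q p = source Q q then basis_vec (concat_path p q) else 0)"

text \<open>
  For \<open>es = \<phi>\<^sub>1 \<dots> \<phi>\<^sub>l\<close>, the lists \<open>take i es\<close> and \<open>drop (i + 1) es\<close> are \<open>\<phi>\<^sub>1 \<dots> \<phi>\<^sub>i\<close> and
  \<open>\<phi>\<^sub>i\<^sub>+\<^sub>2 \<dots> \<phi>\<^sub>l\<close>. The value at the non-path \<open>Arrows []\<close> is irrelevant.
\<close>

fun comult_path ::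
  "('v, 'e) pre_digraph \<Rightarrow> ('v, 'e) qpath \<Rightarrow> (('v, 'e) qpath \<times> ('v, 'e) qpath \<Rightarrow>\<^sub>0 'k::field)" where
  "comult_path Q (Vertex v) = 0"
| "comult_path Q (Arrows []) = 0"
| "comult_path Q (Arrows [e]) = free_tensor (basis_vec (Vertex (tail Q e))) (basis_vec (Vertex (head Q e)))"
| "comult_path Q (Arrows (e # f # es')) =
     (let es = e # f # es' in
        free_tensor (basis_vec (Vertex (tail Q (hd es)))) (basis_vec (Arrows (tl es))) +
        free_tensor (basis_vec (Arrows (butlast es))) (basis_vec (Vertex (head Q (last es)))) +
        (\<Sum>i = 1..length es - 2.
           free_tensor (basis_vec (Arrows (take i es))) (basis_vec (Arrows (drop (i + 1) es)))))"

definition path_comult ::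
  "('v, 'e) pre_digraph \<Rightarrow> (('v, 'e) qpath \<Rightarrow>\<^sub>0 'k::field) \<Rightarrow> (('v, 'e) qpath \<times> ('v, 'e) qpath \<Rightarrow>\<^sub>0 'k)" where
  "path_comult Q = linear_extension (path_space2 Q) (comult_path Q)"

definition induced_map ::
  "('w, 'f) pre_digraph \<Rightarrow> ('v \<Rightarrow> 'w) \<Rightarrow> ('e \<Rightarrow> 'f) \<Rightarrow>
   (('v, 'e) qpath \<Rightarrow>\<^sub>0 'k::field) \<Rightarrow> (('w, 'f) qpath \<Rightarrow>\<^sub>0 'k)" where
  "induced_map Q' \<alpha>0 \<alpha>1 = linear_extension (path_space Q')
     (\<lambda>p. case p of Vertex v \<Rightarrow> basis_vec (Vertex (\<alpha>0 v)) | Arrows es \<Rightarrow> basis_vec (Arrows (map \<alpha>1 es)))"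

end

theory Submission
  imports Defs
begin

text \<open>
  If \<open>\<alpha>\<close> is an endomorphism of an \<open>\<epsilon>\<close>-bialgebra, then functoriality of the tensor product gives
  \<open>\<alpha> \<otimes> \<alpha>\<mu> = (\<alpha> \<otimes> \<alpha>)(id \<otimes> \<mu>)\<close> and \<open>\<alpha> \<otimes> \<Delta>\<alpha> = (id \<otimes> \<Delta>)(\<alpha> \<otimes> \<alpha>)\<close>, and symmetrically. Every axiom of the
  twisted structure \<open>(\<alpha>\<mu>, \<Delta>\<alpha>, \<alpha>)\<close> thereby becomes the corresponding axiom of the original one,
  composed with copies of \<open>\<alpha>\<close> and \<open>\<alpha> \<otimes> \<alpha>\<close>. The comultiplication of a path is the sum, over its arrows,
  of (part before the arrow) \<open>\<otimes>\<close> (part after the arrow); coassociativity sums over pairs of arrows,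
  and the derivation rule splits the arrows of \<open>pq\<close> into those of \<open>p\<close> and those of \<open>q\<close>.
\<close>

section \<open>Free vector spaces\<close>

lemma lookup_map_times:
  fixes x :: "'x \<Rightarrow>\<^sub>0 'k::field"
  shows "Poly_Mapping.lookup (Poly_Mapping.map ((*) c) x) p = c * Poly_Mapping.lookup x p"
  by (simp add: Poly_Mapping.map.rep_eq when_def)

lemma vector_space_map_times:
  "vector_space (\<lambda>c. Poly_Mapping.map ((*) (c::'k::field)) :: ('x \<Rightarrow>\<^sub>0 'k) \<Rightarrow> _)"
  by unfold_locales (auto intro!: poly_mapping_eqI simp: lookup_map_times lookup_add algebra_simps)

lemma vec_free_space: "vec (free_space X) = {x. Poly_Mapping.keys x \<subseteq> X}"
  and scl_free_space: "scl (free_space X) = (\<lambda>c. Poly_Mapping.map ((*) c))"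
  by (simp_all add: free_space_def)

lemma lookup_scl_free_space:
  "Poly_Mapping.lookup (scl (free_space X) c x) p = c * Poly_Mapping.lookup x p"
  by (simp add: scl_free_space lookup_map_times)

lemma keys_scl_free_space:
  "Poly_Mapping.keys (scl (free_space X) c x) \<subseteq> Poly_Mapping.keys x"
  by (auto simp: in_keys_iff lookup_scl_free_space)

lemma basis_vec_in_free_space [simp]: "basis_vec p \<in> vec (free_space X) \<longleftrightarrow> p \<in> X"
  by (simp add: vec_free_space)

text \<open>The scalar action ignores \<open>X\<close>: it makes the whole type of finitely
  supported functions a vector space, in which \<open>X\<close> only cuts out a subspace.\<close>

lemma is_vspace_free_space: "is_vspace (free_space X)"
proof -
  interpret vector_space "scl (free_space X)"
    by (simp add: scl_free_space vector_space_map_times)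
  show ?thesis
    unfolding is_vspace_def
  proof
    show "vector_space (scl (free_space X))" by unfold_locales
    show "subspace (vec (free_space X))"
      unfolding subspace_def vec_free_space
      by (auto dest!: subsetD[OF keys_add] subsetD[OF keys_scl_free_space])
  qed
qed

section \<open>Linear maps between subspaces\<close>

lemma is_vspaceD:
  assumes "is_vspace V"
  shows "vector_space (scl V)" "module (scl V)" "module.subspace (scl V) (vec V)"
    "0 \<in> vec V" "\<And>x y. x \<in> vec V \<Longrightarrow> y \<in> vec V \<Longrightarrow> x + y \<in> vec V"
    "\<And>c x. x \<in> vec V \<Longrightarrow> scl V c x \<in> vec V"
proof -
  show V: "vector_space (scl V)" and S: "module.subspace (scl V) (vec V)"
    using assms by (auto simp: is_vspace_def)
  interpret vector_space "scl V" by (fact V)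
  show "module (scl V)" by unfold_locales
  show "0 \<in> vec V" "\<And>x y. x \<in> vec V \<Longrightarrow> y \<in> vec V \<Longrightarrow> x + y \<in> vec V"
    "\<And>c x. x \<in> vec V \<Longrightarrow> scl V c x \<in> vec V"
    using S by (auto simp: subspace_def)
qed

lemma linear_mapD:
  assumes "linear_map V W f"
  shows "x \<in> vec V \<Longrightarrow> f x \<in> vec W"
    "x \<in> vec V \<Longrightarrow> y \<in> vec V \<Longrightarrow> f (x + y) = f x + f y"
    "x \<in> vec V \<Longrightarrow> f (scl V c x) = scl W c (f x)"
  using assms by (auto simp: linear_map_def)

lemma linear_map_0:
  assumes "is_vspace V" "linear_map V W f"
  shows "f 0 = 0"
  using linear_mapD(2)[OF assms(2), of 0 0] is_vspaceD(4)[OF assms(1)] by simp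

lemma linear_map_sum:
  assumes "is_vspace V" "linear_map V W f" "\<And>i. i \<in> I \<Longrightarrow> g i \<in> vec V"
  shows "f (\<Sum>i\<in>I. g i) = (\<Sum>i\<in>I. f (g i))"
proof -
  interpret vector_space "scl V" using assms by (auto dest: is_vspaceD)
  have S: "subspace (vec V)" using assms by (auto dest: is_vspaceD)
  show ?thesis
    using assms(3)
    \<comment> \<open>A sum over an infinite set is 0 by convention, so that case comes down to
      \<open>f 0 = 0\<close>.\<close>
    by (induction I rule: infinite_finite_induct)
      (simp_all add: linear_map_0[OF assms(1,2)] linear_mapD(2)[OF assms(2)] subspace_sum[OF S])
qed

lemma linear_map_id: "linear_map V V id"
  by (simp add: linear_map_def)

lemma linear_map_comp:
  "linear_map U V f \<Longrightarrow> linear_map V W g \<Longrightarrow> linear_map U W (g \<circ> f)"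
  by (auto simp: linear_map_def)

lemma linear_map_add:
  assumes "is_vspace W" "linear_map V W f" "linear_map V W g"
  shows "linear_map V W (\<lambda>x. f x + g x)"
proof -
  interpret vector_space "scl W" using assms by (auto dest: is_vspaceD)
  show ?thesis
    using assms is_vspaceD[OF assms(1)] by (auto simp: linear_map_def scale_right_distrib)
qed

section \<open>Linear extension from a basis\<close>

text \<open>Indices outside the support have coefficient zero, so the support may be enlarged.
  Different vectors can then be expanded over one common index set.\<close>

lemma linear_extension_superset:
  assumes "vector_space (scl V)" "finite K" "Poly_Mapping.keys x \<subseteq> K"
  shows "linear_extension V f x = (\<Sum>p\<in>K. scl V (Poly_Mapping.lookup x p) (f p))"
proof -
  interpret vector_space "scl V" by fact
  show ?thesis
    unfolding linear_extension_def using assms(2,3)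
    by (intro sum.mono_neutral_left) (auto simp: in_keys_iff)
qed

lemma linear_extension_add:
  assumes "vector_space (scl V)"
  shows "linear_extension V f (x + y) = linear_extension V f x + linear_extension V f y"
proof -
  interpret vector_space "scl V" by fact
  \<comment> \<open>Cancellation can make the support of the sum smaller than this union, but never
    larger.\<close>
  let ?K = "Poly_Mapping.keys x \<union> Poly_Mapping.keys y"
  show ?thesis
    using linear_extension_superset[OF assms, of ?K _ f] keys_add[of x y]
    by (simp add: lookup_add scale_left_distrib sum.distrib)
qed

lemma linear_extension_scale:
  assumes "vector_space (scl V)"
  shows "linear_extension V f (scl (free_space X) c x) = scl V c (linear_extension V f x)"
proof -
  interpret vector_space "scl V" by fact
  show ?thesis
    using linear_extension_superset[OF assms _ keys_scl_free_space, where f = f]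
      linear_extension_superset[OF assms, of "Poly_Mapping.keys x" x f]
    by (simp add: lookup_scl_free_space scale_sum_right)
qed

lemma linear_extension_single:
  assumes "vector_space (scl V)"
  shows "linear_extension V f (Poly_Mapping.single p c) = scl V c (f p)"
proof -
  interpret vector_space "scl V" by fact
  show ?thesis by (simp add: linear_extension_def)
qed

lemma linear_extension_basis_vec:
  assumes "vector_space (scl V)"
  shows "linear_extension V f (basis_vec p) = f p"
proof -
  interpret vector_space "scl V" by fact
  show ?thesis by (simp add: linear_extension_single[OF assms])
qed

lemma linear_map_linear_extension:
  fixes V :: "('k::field, 'a::ab_group_add) vspace" and X :: "'x set"
  assumes "is_vspace V" "\<And>p. p \<in> X \<Longrightarrow> f p \<in> vec V"
  shows "linear_map (free_space X) V (linear_extension V f)"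
proof -
  have V: "vector_space (scl V)" and S: "module.subspace (scl V) (vec V)"
    using assms by (auto dest: is_vspaceD)
  interpret vector_space "scl V" by (fact V)
  show ?thesis
    unfolding linear_map_def
  proof (intro conjI ballI allI)
    fix x :: "'x \<Rightarrow>\<^sub>0 'k"
    assume "x \<in> vec (free_space X)"
    then show "linear_extension V f x \<in> vec V"
      unfolding linear_extension_def
      using assms(2) by (auto simp: vec_free_space intro!: subspace_sum[OF S] subspace_scale[OF S])
  qed (auto simp: linear_extension_add[OF V] linear_extension_scale[OF V])
qed

text \<open>An element is the finite combination of the basis vectors in its support. The set
  \<open>Y\<close> enters only through the scalar action, which is the same for all index
  sets.\<close>

lemma free_space_induct:
  fixes x :: "'x \<Rightarrow>\<^sub>0 'k::field"
  assumes "x \<in> vec (free_space X)" "module.subspace (scl (free_space Y)) S"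
    and "\<And>p. p \<in> X \<Longrightarrow> basis_vec p \<in> S"
  shows "x \<in> S"
proof -
  interpret vector_space "scl (free_space Y :: ('k, 'x \<Rightarrow>\<^sub>0 'k) vspace)"
    by (simp add: scl_free_space vector_space_map_times)
  have "x = (\<Sum>p\<in>Poly_Mapping.keys x. scl (free_space Y) (Poly_Mapping.lookup x p) (basis_vec p))"
    by (rule poly_mapping_eqI)
      (auto simp: lookup_sum lookup_scl_free_space lookup_single when_def if_distrib in_keys_iff
          sum.delta cong: if_cong)
  also have "\<dots> \<in> S"
    using assms by (auto simp: vec_free_space intro!: subspace_sum subspace_scale)
  finally show ?thesis .
qed

text \<open>The vectors on which the two maps agree form a subspace containing the basis. This
  reduces identities between linear maps on the path algebra to statements about paths.\<close>

lemma free_space_linear_map_eqI: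
  fixes f g :: "('x \<Rightarrow>\<^sub>0 'k::field) \<Rightarrow> 'b::ab_group_add"
  assumes "is_vspace W" "linear_map (free_space X) W f" "linear_map (free_space X) W g"
    and "\<And>p. p \<in> X \<Longrightarrow> f (basis_vec p) = g (basis_vec p)" "x \<in> vec (free_space X)"
  shows "f x = g x"
proof -
  interpret F: vector_space "scl (free_space X :: ('k, 'x \<Rightarrow>\<^sub>0 'k) vspace)"
    by (simp add: scl_free_space vector_space_map_times)
  have "is_vspace (free_space X :: ('k, 'x \<Rightarrow>\<^sub>0 'k) vspace)" by (rule is_vspace_free_space)
  note F = is_vspaceD[OF this]
  let ?S = "{x \<in> vec (free_space X). f x = g x}"
  have "F.subspace ?S"
    unfolding F.subspace_def
    using F(4-6) linear_map_0[OF is_vspace_free_space assms(2)]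
      linear_map_0[OF is_vspace_free_space assms(3)] linear_mapD(2,3)[OF assms(2)]
      linear_mapD(2,3)[OF assms(3)] by auto
  then have "x \<in> ?S"
    using assms by (intro free_space_induct[OF assms(5)]) auto
  then show ?thesis by simp
qed

section \<open>Tensor products\<close>

definition bilinear_map ::
  "('k::field, 'a::ab_group_add) vspace \<Rightarrow> ('k, 'b::ab_group_add) vspace \<Rightarrow>
   ('k, 'c::ab_group_add) vspace \<Rightarrow> ('a \<Rightarrow> 'b \<Rightarrow> 'c) \<Rightarrow> bool" where
  "bilinear_map V W U B \<longleftrightarrow>
     (\<forall>a\<in>vec V. linear_map W U (B a)) \<and> (\<forall>b\<in>vec W. linear_map V U (\<lambda>a. B a b))"

lemma bilinear_mapD:
  assumes "bilinear_map V W U B"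
  shows "a \<in> vec V \<Longrightarrow> b \<in> vec W \<Longrightarrow> B a b \<in> vec U"
    "a \<in> vec V \<Longrightarrow> a' \<in> vec V \<Longrightarrow> b \<in> vec W \<Longrightarrow> B (a + a') b = B a b + B a' b"
    "a \<in> vec V \<Longrightarrow> b \<in> vec W \<Longrightarrow> b' \<in> vec W \<Longrightarrow> B a (b + b') = B a b + B a b'"
    "a \<in> vec V \<Longrightarrow> b \<in> vec W \<Longrightarrow> B (scl V c a) b = scl U c (B a b)"
    "a \<in> vec V \<Longrightarrow> b \<in> vec W \<Longrightarrow> B a (scl W c b) = scl U c (B a b)"
  using assms by (auto simp: bilinear_map_def linear_map_def)

lemma bilinear_map_compose:
  assumes "bilinear_map V' W' U B" "linear_map V V' f" "linear_map W W' g"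
  shows "bilinear_map V W U (\<lambda>a b. B (f a) (g b))"
  using bilinear_mapD[OF assms(1)] linear_mapD[OF assms(2)] linear_mapD[OF assms(3)]
  by (simp add: bilinear_map_def linear_map_def)

lemma linear_map_bilinear_map:
  assumes "bilinear_map V W U B" "linear_map U U' f"
  shows "bilinear_map V W U' (\<lambda>a b. f (B a b))"
  using bilinear_mapD[OF assms(1)] linear_mapD[OF assms(2)]
  by (simp add: bilinear_map_def linear_map_def)

text \<open>The kernel of the extension is a subspace, and bilinearity of \<open>B\<close> puts
  every generating relation into it. Hence the extension descends to the quotient that defines the
  tensor product.\<close>

lemma linear_extension_bilinear_relations:
  fixes V :: "('k::field, 'a::ab_group_add) vspace" and W :: "('k, 'b::ab_group_add) vspace"
    and U :: "('k, 'c::ab_group_add) vspace" and X :: "('a \<times> 'b) set"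
  assumes "is_vspace V" "is_vspace W" "is_vspace U" "bilinear_map V W U B"
    and "x \<in> module.span (scl (free_space X :: ('k, 'a \<times> 'b \<Rightarrow>\<^sub>0 'k) vspace)) (bilinear_relations V W)"
  shows "linear_extension U (\<lambda>(a, b). B a b) x = 0"
proof -
  have U: "vector_space (scl U)" using assms by (auto dest: is_vspaceD)
  interpret U: vector_space "scl U" by (fact U)
  interpret F: vector_space "scl (free_space X :: ('k, 'a \<times> 'b \<Rightarrow>\<^sub>0 'k) vspace)"
    by (simp add: scl_free_space vector_space_map_times)
  let ?h = "linear_extension U (\<lambda>(a, b). B a b)"
  have h_add: "?h (y + z) = ?h y + ?h z" for y z
    by (rule linear_extension_add[OF U])
  have h_minus: "?h (y - z) = ?h y - ?h z" for y z
    using h_add[of "y - z" z] by (simp add: algebra_simps)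
  have "F.subspace {x. ?h x = 0}"
    by (auto simp: F.subspace_def h_add linear_extension_scale[OF U] linear_extension_def[of U _ 0])
  moreover have "bilinear_relations V W \<subseteq> {x. ?h x = 0}"
    using bilinear_mapD[OF assms(4)]
    by (auto simp: bilinear_relations_def h_minus linear_extension_single[OF U])
  ultimately have "F.span (bilinear_relations V W) \<subseteq> {x. ?h x = 0}"
    by (rule F.span_minimal[rotated])
  then show ?thesis using assms(5) by auto
qed

lemma tensor_productD:
  fixes V :: "('k::field, 'a::ab_group_add) vspace" and W :: "('k, 'b::ab_group_add) vspace"
  assumes "tensor_product V W T t"
  shows "is_vspace V" "is_vspace W" "is_vspace T"
    "linear_extension T (\<lambda>(a, b). t a b) ` vec (free_space (vec V \<times> vec W)) = vec T"
    "\<And>x. x \<in> vec (free_space (vec V \<times> vec W)) \<Longrightarrow> linear_extension T (\<lambda>(a, b). t a b) x = 0 \<longleftrightarrow>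
      x \<in> module.span (scl (free_space (vec V \<times> vec W) :: ('k, 'a \<times> 'b \<Rightarrow>\<^sub>0 'k) vspace))
        (bilinear_relations V W)"
  using assms unfolding tensor_product_def Let_def by blast+

text \<open>Each generating relation lies in the kernel of the projection to \<open>T\<close>;
  evaluating the projection on it gives the corresponding law for \<open>t\<close>.\<close>

lemma tensor_product_bilinear:
  fixes V :: "('k::field, 'a::ab_group_add) vspace" and W :: "('k, 'b::ab_group_add) vspace"
  assumes "tensor_product V W T t"
  shows "bilinear_map V W T t"
proof -
  note T = tensor_productD[OF assms]
  note V = is_vspaceD[OF T(1)] and W = is_vspaceD[OF T(2)]
  let ?F = "free_space (vec V \<times> vec W) :: ('k, 'a \<times> 'b \<Rightarrow>\<^sub>0 'k) vspace"
  let ?\<pi> = "linear_extension T (\<lambda>(a, b). t a b)"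
  have sT: "vector_space (scl T)" using T by (auto dest: is_vspaceD)
  interpret T: vector_space "scl T" by (fact sT)
  interpret F: vector_space "scl ?F"
    by (simp add: scl_free_space vector_space_map_times)
  have F: "is_vspace ?F" by (rule is_vspace_free_space)
  note sF = is_vspaceD[OF F]
  have \<pi>_minus: "?\<pi> (y - z) = ?\<pi> y - ?\<pi> z" for y z
    using linear_extension_add[OF sT, of _ "y - z" z] by (simp add: algebra_simps)
  have rel: "?\<pi> x = 0" if "x \<in> bilinear_relations V W" "x \<in> vec ?F" for x
    using T(5)[OF that(2)] F.span_base[OF that(1)] by blast
  have minus: "x - y \<in> vec ?F" if "x \<in> vec ?F" "y \<in> vec ?F" for x y
    using F.subspace_diff[OF sF(3) that] .
  have single: "Poly_Mapping.single (a, b) c \<in> vec ?F" if "a \<in> vec V" "b \<in> vec W" for a b c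
    using that by (auto simp: vec_free_space)
  have \<pi>_single: "?\<pi> (Poly_Mapping.single (a, b) c) = scl T c (t a b)" for a b c
    by (simp add: linear_extension_single[OF sT])
  have in_T: "t a b \<in> vec T" if "a \<in> vec V" "b \<in> vec W" for a b
  proof -
    have "t a b = ?\<pi> (Poly_Mapping.single (a, b) 1)" by (simp add: \<pi>_single)
    then show ?thesis using T(4) single[OF that, of 1] by blast
  qed
  have add_l: "t (a + a') b = t a b + t a' b" if "a \<in> vec V" "a' \<in> vec V" "b \<in> vec W" for a a' b
  proof -
    have "?\<pi> (basis_vec (a + a', b) - basis_vec (a, b) - basis_vec (a', b)) = 0"
      using that by (intro rel minus single V) (unfold bilinear_relations_def, blast)
    then show ?thesis
      by (simp only: \<pi>_minus \<pi>_single T.scale_one) (simp add: algebra_simps)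
  qed
  have add_r: "t a (b + b') = t a b + t a b'" if "a \<in> vec V" "b \<in> vec W" "b' \<in> vec W" for a b b'
  proof -
    have "?\<pi> (basis_vec (a, b + b') - basis_vec (a, b) - basis_vec (a, b')) = 0"
      using that by (intro rel minus single W) (unfold bilinear_relations_def, blast)
    then show ?thesis
      by (simp only: \<pi>_minus \<pi>_single T.scale_one) (simp add: algebra_simps)
  qed
  have scl_l: "t (scl V c a) b = scl T c (t a b)" if "a \<in> vec V" "b \<in> vec W" for a b c
  proof -
    have "?\<pi> (basis_vec (scl V c a, b) - Poly_Mapping.single (a, b) c) = 0"
      using that by (intro rel minus single V) (unfold bilinear_relations_def, blast)
    then show ?thesis by (simp add: \<pi>_minus \<pi>_single)
  qed
  have scl_r: "t a (scl W c b) = scl T c (t a b)" if "a \<in> vec V" "b \<in> vec W" for a b c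
  proof -
    have "?\<pi> (basis_vec (a, scl W c b) - Poly_Mapping.single (a, b) c) = 0"
      using that by (intro rel minus single W) (unfold bilinear_relations_def, blast)
    then show ?thesis by (simp add: \<pi>_minus \<pi>_single)
  qed
  show ?thesis
    using in_T add_l add_r scl_l scl_r by (simp add: bilinear_map_def linear_map_def)
qed

text \<open>The projection from the free space is onto \<open>vec T\<close>, so it suffices to
  compare the composites with it; these are determined by basis vectors, whose images are the pure
  tensors.\<close>

lemma tensor_product_eqI:
  fixes V :: "('k::field, 'a::ab_group_add) vspace" and W :: "('k, 'b::ab_group_add) vspace"
  assumes "tensor_product V W T t" "is_vspace U" "linear_map T U f" "linear_map T U g"
    and "\<And>a b. a \<in> vec V \<Longrightarrow> b \<in> vec W \<Longrightarrow> f (t a b) = g (t a b)"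
    and "x \<in> vec T"
  shows "f x = g x"
proof -
  note T = tensor_productD[OF assms(1)]
  have sT: "vector_space (scl T)" using T by (auto dest: is_vspaceD)
  let ?F = "free_space (vec V \<times> vec W) :: ('k, 'a \<times> 'b \<Rightarrow>\<^sub>0 'k) vspace"
  let ?\<pi> = "linear_extension T (\<lambda>(a, b). t a b)"
  have \<pi>: "linear_map ?F T ?\<pi>"
    using bilinear_mapD(1)[OF tensor_product_bilinear[OF assms(1)]]
    by (intro linear_map_linear_extension T) auto
  obtain y where y: "y \<in> vec ?F" "x = ?\<pi> y"
    using T(4) assms(6) by blast
  have "(f \<circ> ?\<pi>) y = (g \<circ> ?\<pi>) y"
    by (rule free_space_linear_map_eqI[OF assms(2) linear_map_comp[OF \<pi> assms(3)]
          linear_map_comp[OF \<pi> assms(4)] _ y(1)])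
      (auto simp: linear_extension_basis_vec[OF sT] assms(5))
  then show ?thesis using y by simp
qed

section \<open>Universal property and functoriality\<close>

lemma tensor_product_universal:
  fixes V :: "('k::field, 'a::ab_group_add) vspace" and W :: "('k, 'b::ab_group_add) vspace"
  assumes "tensor_product V W T t" "is_vspace U" "bilinear_map V W U B"
  shows "\<exists>h. linear_map T U h \<and> (\<forall>a\<in>vec V. \<forall>b\<in>vec W. h (t a b) = B a b)"
proof -
  note T = tensor_productD[OF assms(1)]
  let ?F = "free_space (vec V \<times> vec W) :: ('k, 'a \<times> 'b \<Rightarrow>\<^sub>0 'k) vspace"
  let ?\<pi> = "linear_extension T (\<lambda>(a, b). t a b)"
  let ?k = "linear_extension U (\<lambda>(a, b). B a b)"
  have sT: "vector_space (scl T)" using T by (auto dest: is_vspaceD)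
  have sU: "vector_space (scl U)" using assms by (auto dest: is_vspaceD)
  interpret F: vector_space "scl ?F"
    by (simp add: scl_free_space vector_space_map_times)
  have F: "is_vspace ?F" by (rule is_vspace_free_space)
  note sF = is_vspaceD[OF F]
  have \<pi>_minus: "?\<pi> (y - z) = ?\<pi> y - ?\<pi> z" for y z
    using linear_extension_add[OF sT, of _ "y - z" z] by (simp add: algebra_simps)
  have k_minus: "?k (y - z) = ?k y - ?k z" for y z
    using linear_extension_add[OF sU, of _ "y - z" z] by (simp add: algebra_simps)
  have \<pi>: "linear_map ?F T ?\<pi>"
    using bilinear_mapD(1)[OF tensor_product_bilinear[OF assms(1)]]
    by (intro linear_map_linear_extension T) auto
  have k: "linear_map ?F U ?k"
    using bilinear_mapD(1)[OF assms(3)] by (intro linear_map_linear_extension assms) auto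
  \<comment> \<open>\<open>h\<close> evaluates the extension of \<open>B\<close> at an arbitrary
    preimage under the projection. Two preimages differ by an element of the span of the bilinearity
    relations, which that extension kills, so the choice does not matter.\<close>
  define h where "h x = ?k (SOME y. y \<in> vec ?F \<and> ?\<pi> y = x)" for x
  have h: "h (?\<pi> y) = ?k y" if "y \<in> vec ?F" for y
  proof -
    define z where "z = (SOME z. z \<in> vec ?F \<and> ?\<pi> z = ?\<pi> y)"
    have "z \<in> vec ?F \<and> ?\<pi> z = ?\<pi> y"
      unfolding z_def by (rule someI[of _ y]) (simp add: that)
    then have z: "z \<in> vec ?F" "?\<pi> (z - y) = 0" by (simp_all add: \<pi>_minus)
    then have "z - y \<in> F.span (bilinear_relations V W)"
      using T(5)[of "z - y"] F.subspace_diff[OF sF(3) z(1) that] by blast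
    then have "?k (z - y) = 0"
      by (rule linear_extension_bilinear_relations[OF T(1,2) assms(2,3)])
    then show ?thesis by (simp add: h_def z_def k_minus)
  qed
  have "linear_map T U h"
    unfolding linear_map_def T(4)[symmetric]
    using sF(5,6) linear_mapD(1)[OF k]
    by (simp add: h linear_extension_add[OF sT, symmetric] linear_extension_add[OF sU, symmetric]
        linear_extension_scale[OF sT, of _ "vec V \<times> vec W", symmetric]
        linear_extension_scale[OF sU, of _ "vec V \<times> vec W", symmetric])
  moreover have "h (t a b) = B a b" if "a \<in> vec V" "b \<in> vec W" for a b
    using h[of "basis_vec (a, b)"] that
    by (simp add: linear_extension_basis_vec[OF sT] linear_extension_basis_vec[OF sU])
  ultimately show ?thesis by blast
qed

text \<open>The map \<open>\<lambda>a b. t' (f a) (g b)\<close> is bilinear, so the universal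
  property supplies a witness for the choice made in \<open>tensor_map\<close>.\<close>

lemma tensor_map:
  assumes "tensor_product V W T t" "tensor_product V' W' T' t'"
    and "linear_map V V' f" "linear_map W W' g"
  shows linear_map_tensor_map: "linear_map T T' (tensor_map V W T t T' t' f g)"
    and tensor_map_apply: "\<And>a b. a \<in> vec V \<Longrightarrow> b \<in> vec W \<Longrightarrow>
      tensor_map V W T t T' t' f g (t a b) = t' (f a) (g b)"
proof -
  have "\<exists>h. linear_map T T' h \<and> (\<forall>a\<in>vec V. \<forall>b\<in>vec W. h (t a b) = t' (f a) (g b))"
    using assms
    by (intro tensor_product_universal bilinear_map_compose[OF tensor_product_bilinear])
      (auto dest: tensor_productD)
  from someI_ex[OF this]
  show "linear_map T T' (tensor_map V W T t T' t' f g)"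
    and "\<And>a b. a \<in> vec V \<Longrightarrow> b \<in> vec W \<Longrightarrow>
      tensor_map V W T t T' t' f g (t a b) = t' (f a) (g b)"
    unfolding tensor_map_def by auto
qed

text \<open>Both sides are linear and send \<open>t a b\<close> to
  \<open>t'' (f' (f a)) (g' (g b))\<close>. Agreement is asserted on \<open>vec T\<close>, where
  these chosen maps are determined.\<close>

lemma tensor_map_comp:
  assumes "tensor_product V W T t" "tensor_product V' W' T' t'" "tensor_product V'' W'' T'' t''"
    and "linear_map V V' f" "linear_map W W' g" "linear_map V' V'' f'" "linear_map W' W'' g'"
    and "x \<in> vec T"
  shows "tensor_map V W T t T'' t'' (f' \<circ> f) (g' \<circ> g) x =
    tensor_map V' W' T' t' T'' t'' f' g' (tensor_map V W T t T' t' f g x)"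
proof -
  note L = tensor_map[OF assms(1,2,4,5)] tensor_map[OF assms(2,3,6,7)]
    tensor_map[OF assms(1,3) linear_map_comp[OF assms(4,6)] linear_map_comp[OF assms(5,7)]]
  have "tensor_map V W T t T'' t'' (f' \<circ> f) (g' \<circ> g) x =
    (tensor_map V' W' T' t' T'' t'' f' g' \<circ> tensor_map V W T t T' t' f g) x"
    by (rule tensor_product_eqI[OF assms(1) tensor_productD(3)[OF assms(3)] L(5)
          linear_map_comp[OF L(1,3)] _ assms(8)])
      (auto simp: L linear_mapD(1)[OF assms(4)] linear_mapD(1)[OF assms(5)])
  then show ?thesis by simp
qed

section \<open>Twisting a bialgebra by an endomorphism\<close>

text \<open>With twist \<open>id\<close> the hypothesis \<open>bialgebra\<close> describes an
  ordinary \<epsilon>-bialgebra; \<open>linear\<close>, \<open>mult\<close> and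
  \<open>comult\<close> together make \<open>\<alpha>\<close> an endomorphism of it.\<close>

theorem eps_hom_bialgebra_twist:
  assumes bialgebra: "eps_hom_bialgebra A A2 tens A3 tensl tensr \<mu> \<Delta> id"
    and linear: "linear_map A A \<alpha>"
    and mult: "\<And>x. x \<in> vec A2 \<Longrightarrow> \<alpha> (\<mu> x) = \<mu> (tensor_map A A A2 tens A2 tens \<alpha> \<alpha> x)"
    and comult: "\<And>x. x \<in> vec A \<Longrightarrow> tensor_map A A A2 tens A2 tens \<alpha> \<alpha> (\<Delta> x) = \<Delta> (\<alpha> x)"
  shows "eps_hom_bialgebra A A2 tens A3 tensl tensr (\<alpha> \<circ> \<mu>) (\<Delta> \<circ> \<alpha>) \<alpha>"
proof -
  interpret B: eps_hom_bialgebra A A2 tens A3 tensl tensr \<mu> \<Delta> id by (fact bialgebra)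
  note lin = linear B.mult_linear B.comult_linear linear_map_id
  note sq = B.square and cl = B.cube_left and cr = B.cube_right
  let ?\<alpha>\<alpha> = "B.map_1_1 \<alpha> \<alpha>"
  have lin\<alpha>\<alpha>: "linear_map A2 A2 ?\<alpha>\<alpha>"
    unfolding B.map_1_1_def by (rule linear_map_tensor_map[OF sq sq linear linear])
  have lin1\<mu>: "linear_map A3 A2 (B.map_1_mult id \<mu>)"
    unfolding B.map_1_mult_def by (rule linear_map_tensor_map[OF cr sq lin(4,2)])
  have lin\<mu>1: "linear_map A3 A2 (B.map_mult_1 \<mu> id)"
    unfolding B.map_mult_1_def by (rule linear_map_tensor_map[OF cl sq lin(2,4)])
  have lin1\<Delta>: "linear_map A2 A3 (B.map_1_comult id \<Delta>)"
    unfolding B.map_1_comult_def by (rule linear_map_tensor_map[OF sq cr lin(4,3)])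
  have lin\<Delta>1: "linear_map A2 A3 (B.map_comult_1 \<Delta> id)"
    unfolding B.map_comult_1_def by (rule linear_map_tensor_map[OF sq cl lin(3,4)])
  note closed = linear_mapD(1)[OF linear] linear_mapD(1)[OF lin(2)] linear_mapD(1)[OF lin(3)]
    linear_mapD(1)[OF lin\<alpha>\<alpha>] linear_mapD(1)[OF lin1\<mu>] linear_mapD(1)[OF lin\<mu>1]
    linear_mapD(1)[OF lin1\<Delta>] linear_mapD(1)[OF lin\<Delta>1]
  have \<alpha>\<mu>: "\<alpha> (\<mu> x) = \<mu> (?\<alpha>\<alpha> x)" if "x \<in> vec A2" for x
    using mult[OF that] by (simp add: B.map_1_1_def)
  have \<Delta>\<alpha>: "?\<alpha>\<alpha> (\<Delta> x) = \<Delta> (\<alpha> x)" if "x \<in> vec A" for x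
    using comult[OF that] by (simp add: B.map_1_1_def)
  \<comment> \<open>In this identity and the next, the plain factor \<open>\<alpha>\<close> is read
    as \<open>\<alpha> \<circ> id\<close>, so that \<open>\<alpha>\<close> can leave both tensor
    factors on the outside.\<close>
  have split_1_mult: "B.map_1_mult \<alpha> (\<alpha> \<circ> \<mu>) x = ?\<alpha>\<alpha> (B.map_1_mult id \<mu> x)" if "x \<in> vec A3" for x
    using tensor_map_comp[OF cr sq sq lin(4,2) linear linear that]
    by (simp add: B.map_1_mult_def B.map_1_1_def)
  have split_mult_1: "B.map_mult_1 (\<alpha> \<circ> \<mu>) \<alpha> x = ?\<alpha>\<alpha> (B.map_mult_1 \<mu> id x)" if "x \<in> vec A3" for x
    using tensor_map_comp[OF cl sq sq lin(2,4) linear linear that]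
    by (simp add: B.map_mult_1_def B.map_1_1_def)
  \<comment> \<open>Here and in the next identity \<open>\<alpha>\<close> is read as
    \<open>id \<circ> \<alpha>\<close> and leaves on the inside.\<close>
  have split_1_comult: "B.map_1_comult \<alpha> (\<Delta> \<circ> \<alpha>) x = B.map_1_comult id \<Delta> (?\<alpha>\<alpha> x)"
    if "x \<in> vec A2" for x
    using tensor_map_comp[OF sq sq cr linear linear lin(4,3) that]
    by (simp add: B.map_1_comult_def B.map_1_1_def)
  have split_comult_1: "B.map_comult_1 (\<Delta> \<circ> \<alpha>) \<alpha> x = B.map_comult_1 \<Delta> id (?\<alpha>\<alpha> x)"
    if "x \<in> vec A2" for x
    using tensor_map_comp[OF sq sq cl linear linear lin(3,4) that]
    by (simp add: B.map_comult_1_def B.map_1_1_def)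
  note split = split_1_mult split_mult_1 split_1_comult split_comult_1
  show ?thesis
  proof
    show "linear_map A2 A (\<alpha> \<circ> \<mu>)" "linear_map A A2 (\<Delta> \<circ> \<alpha>)" "linear_map A A \<alpha>"
      using linear_map_comp lin by blast+
    show "(\<alpha> \<circ> (\<alpha> \<circ> \<mu>)) x = (\<alpha> \<circ> \<mu> \<circ> ?\<alpha>\<alpha>) x" if "x \<in> vec A2" for x
      using that by (simp add: \<alpha>\<mu> closed)
    \<comment> \<open>Once \<open>?\<alpha>\<alpha>\<close> is moved out through
      \<open>\<mu>\<close>, both sides are \<open>\<alpha> \<circ> \<alpha>\<close> applied to the
      two sides of associativity at \<open>x\<close>.\<close>
    show "(\<alpha> \<circ> \<mu> \<circ> B.map_1_mult \<alpha> (\<alpha> \<circ> \<mu>)) x = (\<alpha> \<circ> \<mu> \<circ> B.map_mult_1 (\<alpha> \<circ> \<mu>) \<alpha>) x"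
      if "x \<in> vec A3" for x
      using that B.hom_assoc[OF that] by (simp add: split closed flip: \<alpha>\<mu>)
    show "(?\<alpha>\<alpha> \<circ> (\<Delta> \<circ> \<alpha>)) x = (\<Delta> \<circ> \<alpha> \<circ> \<alpha>) x" if "x \<in> vec A" for x
      using that by (simp add: \<Delta>\<alpha> closed)
    show "(B.map_1_comult \<alpha> (\<Delta> \<circ> \<alpha>) \<circ> (\<Delta> \<circ> \<alpha>)) x =
      (B.map_comult_1 (\<Delta> \<circ> \<alpha>) \<alpha> \<circ> (\<Delta> \<circ> \<alpha>)) x" if "x \<in> vec A" for x
      \<comment> \<open>Here both copies of \<open>\<alpha>\<close> move inward through
        \<open>\<Delta>\<close>, hence the instance at \<open>\<alpha> (\<alpha> x)\<close>.\<close>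
      using B.hom_coassoc[of "\<alpha> (\<alpha> x)"] that by (simp add: split \<Delta>\<alpha> closed)
    show "(\<Delta> \<circ> \<alpha> \<circ> (\<alpha> \<circ> \<mu>)) x =
      (B.map_mult_1 (\<alpha> \<circ> \<mu>) \<alpha> \<circ> B.map_1_comult \<alpha> (\<Delta> \<circ> \<alpha>)) x +
      (B.map_1_mult \<alpha> (\<alpha> \<circ> \<mu>) \<circ> B.map_comult_1 (\<Delta> \<circ> \<alpha>) \<alpha>) x" if "x \<in> vec A2" for x
    proof -
      \<comment> \<open>One copy of \<open>\<alpha>\<close> moves outward through
        \<open>\<Delta>\<close> and the other inward through \<open>\<mu>\<close>, so the untwisted
        derivation rule ends up with \<open>?\<alpha>\<alpha>\<close> on either side of it.\<close>
      have "(\<Delta> \<circ> \<alpha> \<circ> (\<alpha> \<circ> \<mu>)) x = ?\<alpha>\<alpha> (\<Delta> (\<mu> (?\<alpha>\<alpha> x)))"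
        using that by (simp add: \<Delta>\<alpha> closed flip: \<alpha>\<mu>)
      also have "\<Delta> (\<mu> (?\<alpha>\<alpha> x)) =
        B.map_mult_1 \<mu> id (B.map_1_comult id \<Delta> (?\<alpha>\<alpha> x)) + B.map_1_mult id \<mu> (B.map_comult_1 \<Delta> id (?\<alpha>\<alpha> x))"
        using B.derivation[of "?\<alpha>\<alpha> x"] that by (simp add: closed)
      finally show ?thesis
        using that by (simp add: split closed linear_mapD(2)[OF lin\<alpha>\<alpha>])
    qed
  qed
qed

section \<open>Tensor products of free vector spaces\<close>

text \<open>Pairs of basis vectors give a basis of the tensor product. The bijection
  \<open>\<phi>\<close> separates the index set \<open>Z\<close> from the literal product, so that
  the argument covers \<open>free_tensor\<close> as well as the reassociating
  \<open>free_tensor_left\<close>.\<close>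

lemma tensor_product_free_space:
  fixes X :: "'x set" and Y :: "'y set" and Z :: "'z set"
    and t :: "('x \<Rightarrow>\<^sub>0 'k::field) \<Rightarrow> ('y \<Rightarrow>\<^sub>0 'k) \<Rightarrow> ('z \<Rightarrow>\<^sub>0 'k)"
  assumes bij: "bij_betw \<phi> (X \<times> Y) Z"
    and bilinear: "bilinear_map (free_space X) (free_space Y) (free_space Z) t"
    and basis: "\<And>p q. p \<in> X \<Longrightarrow> q \<in> Y \<Longrightarrow> t (basis_vec p) (basis_vec q) = basis_vec (\<phi> (p, q))"
  shows "tensor_product (free_space X) (free_space Y) (free_space Z) t"
proof -
  let ?V = "free_space X :: ('k, 'x \<Rightarrow>\<^sub>0 'k) vspace" and ?W = "free_space Y :: ('k, 'y \<Rightarrow>\<^sub>0 'k) vspace"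
    and ?T = "free_space Z :: ('k, 'z \<Rightarrow>\<^sub>0 'k) vspace"
  let ?F = "free_space (vec ?V \<times> vec ?W) :: ('k, ('x \<Rightarrow>\<^sub>0 'k) \<times> ('y \<Rightarrow>\<^sub>0 'k) \<Rightarrow>\<^sub>0 'k) vspace"
  let ?\<pi> = "linear_extension ?T (\<lambda>(a, b). t a b)"
  let ?R = "bilinear_relations ?V ?W"
  have V: "is_vspace ?V" and W: "is_vspace ?W" and T: "is_vspace ?T" and F: "is_vspace ?F"
    by (rule is_vspace_free_space)+
  note sV = is_vspaceD[OF V] and sW = is_vspaceD[OF W] and sT = is_vspaceD[OF T]
    and sF = is_vspaceD[OF F] and t = bilinear_mapD[OF bilinear]
  interpret V: vector_space "scl ?V" by (fact sV)
  interpret W: vector_space "scl ?W" by (fact sW)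
  interpret T: vector_space "scl ?T" by (fact sT)
  interpret F: vector_space "scl ?F" by (fact sF)
  \<comment> \<open>The linear section of \<open>?\<pi>\<close> with \<open>\<phi> (p, q) \<mapsto> (p, q)\<close>. Modulo the relations,
    \<open>\<sigma> \<circ> ?\<pi>\<close> is the identity, so the kernel of \<open>?\<pi>\<close> is spanned by them.\<close>
  define \<sigma> where "\<sigma> = linear_extension ?F
    (\<lambda>z. case inv_into (X \<times> Y) \<phi> z of (p, q) \<Rightarrow> basis_vec (basis_vec p, basis_vec q))"
  have inv: "inv_into (X \<times> Y) \<phi> z \<in> X \<times> Y" "\<phi> (inv_into (X \<times> Y) \<phi> z) = z" if "z \<in> Z" for z
    using bij that by (auto simp: bij_betw_def intro: inv_into_into f_inv_into_f)
  have inv_\<phi>: "inv_into (X \<times> Y) \<phi> (\<phi> (p, q)) = (p, q)" if "p \<in> X" "q \<in> Y" for p q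
    using bij that by (auto simp: bij_betw_def intro: inv_into_f_f)
  have \<pi>: "linear_map ?F ?T ?\<pi>"
    by (intro linear_map_linear_extension T) (auto simp: t)
  have \<sigma>: "linear_map ?T ?F \<sigma>"
    unfolding \<sigma>_def
  proof (rule linear_map_linear_extension[OF F])
    show "(case inv_into (X \<times> Y) \<phi> z of (p, q) \<Rightarrow> basis_vec (basis_vec p, basis_vec q)) \<in> vec ?F"
      if "z \<in> Z" for z
      using inv[OF that] by (auto split: prod.splits)
  qed
  have \<sigma>_add: "\<sigma> (x + y) = \<sigma> x + \<sigma> y" and \<sigma>_scale: "\<sigma> (scl ?T c x) = scl ?F c (\<sigma> x)" for x y c
    unfolding \<sigma>_def by (rule linear_extension_add[OF sF(1)] linear_extension_scale[OF sF(1)])+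
  have \<pi>_add: "?\<pi> (x + y) = ?\<pi> x + ?\<pi> y" and \<pi>_scale: "?\<pi> (scl ?F c x) = scl ?T c (?\<pi> x)" for x y c
    by (rule linear_extension_add[OF sT(1)] linear_extension_scale[OF sT(1)])+
  have \<sigma>_basis: "\<sigma> (basis_vec z) =
    (case inv_into (X \<times> Y) \<phi> z of (p, q) \<Rightarrow> basis_vec (basis_vec p, basis_vec q))" for z
    unfolding \<sigma>_def by (rule linear_extension_basis_vec[OF sF(1)])
  have \<pi>_basis: "?\<pi> (basis_vec (a, b)) = t a b" for a b
    by (simp add: linear_extension_basis_vec[OF sT(1)])
  have \<pi>\<sigma>: "?\<pi> (\<sigma> z) = z" if "z \<in> vec ?T" for z
  proof -
    have "(?\<pi> \<circ> \<sigma>) z = id z"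
    proof (rule free_space_linear_map_eqI[OF T linear_map_comp[OF \<sigma> \<pi>] linear_map_id _ that])
      fix z assume "z \<in> Z"
      from inv[OF this] show "(?\<pi> \<circ> \<sigma>) (basis_vec z) = id (basis_vec z)"
        by (auto simp: \<sigma>_basis \<pi>_basis basis split: prod.splits)
    qed
    then show ?thesis by simp
  qed
  have add_l: "basis_vec (a + a', b) - basis_vec (a, b) - basis_vec (a', b) \<in> F.span ?R"
    if "a \<in> vec ?V" "a' \<in> vec ?V" "b \<in> vec ?W" for a a' b
    using that by (intro F.span_base) (unfold bilinear_relations_def, blast)
  have add_r: "basis_vec (a, b + b') - basis_vec (a, b) - basis_vec (a, b') \<in> F.span ?R"
    if "a \<in> vec ?V" "b \<in> vec ?W" "b' \<in> vec ?W" for a b b'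
    using that by (intro F.span_base) (unfold bilinear_relations_def, blast)
  have scl_l: "basis_vec (scl ?V c a, b) - scl ?F c (basis_vec (a, b)) \<in> F.span ?R"
    if "a \<in> vec ?V" "b \<in> vec ?W" for a b c
  proof -
    have "basis_vec (scl ?V c a, b) - Poly_Mapping.single (a, b) c \<in> F.span ?R"
      using that by (intro F.span_base) (unfold bilinear_relations_def, blast)
    then show ?thesis by (simp add: scl_free_space)
  qed
  have scl_r: "basis_vec (a, scl ?W c b) - scl ?F c (basis_vec (a, b)) \<in> F.span ?R"
    if "a \<in> vec ?V" "b \<in> vec ?W" for a b c
  proof -
    have "basis_vec (a, scl ?W c b) - Poly_Mapping.single (a, b) c \<in> F.span ?R"
      using that by (intro F.span_base) (unfold bilinear_relations_def, blast)
    then show ?thesis by (simp add: scl_free_space)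
  qed
  \<comment> \<open>\<open>N\<close> collects the elements for which the congruence holds. It is a
    subspace, and it is shown to contain every generator \<open>(a, b)\<close> by expanding first
    \<open>b\<close> and then \<open>a\<close> in the basis.\<close>
  define N where "N = {x. x - \<sigma> (?\<pi> x) \<in> F.span ?R}"
  have N: "F.subspace N"
    unfolding F.subspace_def
  proof (intro conjI ballI allI)
    show "0 \<in> N"
      using \<sigma>_scale[of 0 0] \<pi>_scale[of 0 0] by (simp add: N_def F.span_zero)
    show "x + y \<in> N" if "x \<in> N" "y \<in> N" for x y
    proof -
      have "x + y - \<sigma> (?\<pi> (x + y)) = (x - \<sigma> (?\<pi> x)) + (y - \<sigma> (?\<pi> y))"
        by (simp add: \<pi>_add \<sigma>_add)
      with that show ?thesis unfolding N_def by (simp only: mem_Collect_eq F.span_add)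
    qed
    show "scl ?F c x \<in> N" if "x \<in> N" for c x
    proof -
      have "scl ?F c x - \<sigma> (?\<pi> (scl ?F c x)) = scl ?F c (x - \<sigma> (?\<pi> x))"
        by (simp add: \<pi>_scale \<sigma>_scale F.scale_right_diff_distrib)
      with that show ?thesis unfolding N_def by (simp only: mem_Collect_eq F.span_scale)
    qed
  qed
  have R_F: "?R \<subseteq> vec ?F"
  proof -
    have single: "Poly_Mapping.single (a, b) c \<in> vec ?F" if "a \<in> vec ?V" "b \<in> vec ?W" for a b c
      using that by (auto simp: vec_free_space[of "vec ?V \<times> vec ?W"])
    show ?thesis
      by (auto simp: bilinear_relations_def simp del: basis_vec_in_free_space
          intro!: single F.subspace_diff[OF sF(3)] sV(5,6) sW(5,6))
  qed
  \<comment> \<open>Elements of the span are killed by \<open>?\<pi>\<close> and so lie in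
    \<open>N\<close>; consequently \<open>N\<close> is closed under congruence modulo the
    relations.\<close>
  have R_N: "x \<in> N" if "x \<in> F.span ?R" for x
  proof -
    have "?\<pi> x = 0"
      by (rule linear_extension_bilinear_relations[OF V W T bilinear that])
    then show ?thesis
      using that linear_map_0[OF T \<sigma>] by (simp add: N_def)
  qed
  have N_cong: "x \<in> N" if "x - y \<in> F.span ?R" "y \<in> N" for x y
    using F.subspace_add[OF N R_N[OF that(1)] that(2)] by simp
  \<comment> \<open>The homogeneity relation with scalar 0 puts the generator \<open>(0, b)\<close>
    into the span.\<close>
  have N_0_l: "basis_vec (0, b) \<in> N" if "b \<in> vec ?W" for b
    using R_N[OF scl_l[OF sV(4) that, of 0]] by simp
  have N_0_r: "basis_vec (a, 0) \<in> N" if "a \<in> vec ?V" for a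
    using R_N[OF scl_r[OF that sW(4), of 0]] by simp
  have N_r: "basis_vec (basis_vec p, b) \<in> N" if p: "p \<in> X" and b: "b \<in> vec ?W" for p b
  proof -
    have p': "basis_vec p \<in> vec ?V" using p by simp
    have "b \<in> {b \<in> vec ?W. basis_vec (basis_vec p, b) \<in> N}"
    proof (rule free_space_induct[OF b])
      show "W.subspace {b \<in> vec ?W. basis_vec (basis_vec p, b) \<in> N}"
        unfolding W.subspace_def
      proof (intro conjI ballI allI)
        show "0 \<in> {b \<in> vec ?W. basis_vec (basis_vec p, b) \<in> N}"
          using N_0_r[OF p'] sW(4) by simp
        show "b + b' \<in> {b \<in> vec ?W. basis_vec (basis_vec p, b) \<in> N}"
          if "b \<in> {b \<in> vec ?W. basis_vec (basis_vec p, b) \<in> N}"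
            "b' \<in> {b \<in> vec ?W. basis_vec (basis_vec p, b) \<in> N}" for b b'
          \<comment> \<open>\<open>diff_diff_eq\<close> regroups \<open>x - y - z\<close> as
            \<open>x - (y + z)\<close>, which turns the additivity relation into a
            congruence.\<close>
          using that N_cong[OF add_r[OF p', of b b', unfolded diff_diff_eq]]
          by (simp add: sW(5) F.subspace_add[OF N])
        show "scl ?W c b \<in> {b \<in> vec ?W. basis_vec (basis_vec p, b) \<in> N}"
          if "b \<in> {b \<in> vec ?W. basis_vec (basis_vec p, b) \<in> N}" for c b
          using that N_cong[OF scl_r[OF p', of b c]]
          by (simp add: sW(6) F.subspace_scale[OF N])
      qed
      \<comment> \<open>On a pair of basis vectors \<open>\<sigma>\<close> undoes
        \<open>?\<pi>\<close> exactly, so the difference is 0.\<close>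
      show "basis_vec q \<in> {b \<in> vec ?W. basis_vec (basis_vec p, b) \<in> N}" if "q \<in> Y" for q
        using that p by (simp add: N_def \<pi>_basis basis \<sigma>_basis inv_\<phi> F.span_zero)
    qed
    then show ?thesis by simp
  qed
  have N_basis: "basis_vec (a, b) \<in> N" if a: "a \<in> vec ?V" and b: "b \<in> vec ?W" for a b
  proof -
    have "a \<in> {a \<in> vec ?V. basis_vec (a, b) \<in> N}"
    proof (rule free_space_induct[OF a])
      show "V.subspace {a \<in> vec ?V. basis_vec (a, b) \<in> N}"
        unfolding V.subspace_def
      proof (intro conjI ballI allI)
        show "0 \<in> {a \<in> vec ?V. basis_vec (a, b) \<in> N}"
          using N_0_l[OF b] sV(4) by simp
        show "a + a' \<in> {a \<in> vec ?V. basis_vec (a, b) \<in> N}"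
          if "a \<in> {a \<in> vec ?V. basis_vec (a, b) \<in> N}" "a' \<in> {a \<in> vec ?V. basis_vec (a, b) \<in> N}" for a a'
          using that N_cong[OF add_l[of a a', OF _ _ b, unfolded diff_diff_eq]]
          by (simp add: sV(5) F.subspace_add[OF N])
        show "scl ?V c a \<in> {a \<in> vec ?V. basis_vec (a, b) \<in> N}"
          if "a \<in> {a \<in> vec ?V. basis_vec (a, b) \<in> N}" for c a
          using that N_cong[OF scl_l[of a, OF _ b, of c]]
          by (simp add: sV(6) F.subspace_scale[OF N])
      qed
      show "basis_vec p \<in> {a \<in> vec ?V. basis_vec (a, b) \<in> N}" if "p \<in> X" for p
        using that N_r[OF that b] by simp
    qed
    then show ?thesis by simp
  qed
  have F_N: "x \<in> N" if "x \<in> vec ?F" for x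
    using N_basis by (intro free_space_induct[OF that N]) auto
  have ker: "{x \<in> vec ?F. ?\<pi> x = 0} = F.span ?R"
  proof (intro equalityI subsetI)
    \<comment> \<open>For \<open>x\<close> in the kernel of \<open>?\<pi>\<close>, the difference
      \<open>x - \<sigma> (?\<pi> x)\<close> is \<open>x\<close> itself.\<close>
    show "x \<in> F.span ?R" if "x \<in> {x \<in> vec ?F. ?\<pi> x = 0}" for x
      using F_N[of x] that linear_map_0[OF T \<sigma>] by (simp add: N_def)
    show "x \<in> {x \<in> vec ?F. ?\<pi> x = 0}" if "x \<in> F.span ?R" for x
      using F.span_minimal[OF R_F sF(3)] that linear_extension_bilinear_relations[OF V W T bilinear that]
      by auto
  qed
  have surj: "?\<pi> ` vec ?F = vec ?T"
  proof (intro equalityI subsetI)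
    show "z \<in> vec ?T" if "z \<in> ?\<pi> ` vec ?F" for z
      using that linear_mapD(1)[OF \<pi>] by blast
    show "z \<in> ?\<pi> ` vec ?F" if "z \<in> vec ?T" for z
      using \<pi>\<sigma>[OF that] linear_mapD(1)[OF \<sigma> that] by (metis imageI)
  qed
  show ?thesis
    unfolding tensor_product_def Let_def using V W T ker surj by blast
qed

section \<open>Concrete tensor square and cube\<close>

text \<open>Outside the supports both sides vanish, so the formula holds at all indices. Identities
  between tensors then become identities in the field, coefficient by coefficient.\<close>

lemma lookup_free_tensor:
  "Poly_Mapping.lookup (free_tensor x y) (p, q) = Poly_Mapping.lookup x p * Poly_Mapping.lookup y q"
proof -
  have "Poly_Mapping.lookup (free_tensor x y) (p, q) =
    (\<Sum>p'\<in>Poly_Mapping.keys x. \<Sum>q'\<in>Poly_Mapping.keys y.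
      if p' = p then if q' = q then Poly_Mapping.lookup x p' * Poly_Mapping.lookup y q' else 0 else 0)"
    by (auto simp: free_tensor_def lookup_sum lookup_single when_def intro!: sum.cong)
  also have "\<dots> = (\<Sum>p'\<in>Poly_Mapping.keys x.
      if p' = p then Poly_Mapping.lookup x p' * Poly_Mapping.lookup y q else 0)"
    by (intro sum.cong) (auto simp: sum.delta in_keys_iff)
  also have "\<dots> = Poly_Mapping.lookup x p * Poly_Mapping.lookup y q"
    by (auto simp: sum.delta in_keys_iff)
  finally show ?thesis .
qed

lemma bilinear_map_free_tensor:
  fixes X :: "'x set" and Y :: "'y set"
  shows "bilinear_map (free_space X) (free_space Y) (free_space (X \<times> Y))
    (free_tensor :: ('x \<Rightarrow>\<^sub>0 'k::field) \<Rightarrow> ('y \<Rightarrow>\<^sub>0 'k) \<Rightarrow> _)"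
proof -
  have "free_tensor x y \<in> vec (free_space (X \<times> Y))"
    if "x \<in> vec (free_space X)" "y \<in> vec (free_space Y)" for x :: "'x \<Rightarrow>\<^sub>0 'k" and y :: "'y \<Rightarrow>\<^sub>0 'k"
    using that by (auto simp: vec_free_space in_keys_iff lookup_free_tensor)
  moreover have "free_tensor (x + x') y = free_tensor x y + free_tensor x' y"
    "free_tensor x (y + y') = free_tensor x y + free_tensor x y'"
    "free_tensor (scl (free_space X) c x) y = scl (free_space (X \<times> Y)) c (free_tensor x y)"
    "free_tensor x (scl (free_space Y) c y) = scl (free_space (X \<times> Y)) c (free_tensor x y)"
    for x x' :: "'x \<Rightarrow>\<^sub>0 'k" and y y' :: "'y \<Rightarrow>\<^sub>0 'k" and c
    by (rule poly_mapping_eqI; force simp: lookup_free_tensor lookup_add lookup_scl_free_space algebra_simps)+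
  ultimately show ?thesis by (simp add: bilinear_map_def linear_map_def)
qed

lemma free_tensor_basis_vec: "free_tensor (basis_vec p) (basis_vec q) = basis_vec (p, q)"
  by (simp add: free_tensor_def)

lemma tensor_product_free_tensor:
  "tensor_product (free_space X) (free_space Y) (free_space (X \<times> Y)) free_tensor"
  by (rule tensor_product_free_space[where \<phi> = id])
    (simp_all add: bilinear_map_free_tensor free_tensor_basis_vec)

lemma free_tensor_left_basis_vec:
  "free_tensor_left (basis_vec (p, q)) (basis_vec r) = basis_vec (p, q, r)"
  by (simp add: free_tensor_left_def free_tensor_basis_vec
      linear_extension_basis_vec[OF is_vspaceD(1)[OF is_vspace_free_space]])

text \<open>A free space enters a linear extension only through its scalar action. This transfers
  \<open>free_tensor_left\<close>, defined over \<open>UNIV\<close>, to a given index set.\<close>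

lemma linear_extension_free_space_cong:
  "linear_extension (free_space X) f = linear_extension (free_space Y) f"
  by (simp add: fun_eq_iff linear_extension_def scl_free_space)

lemma bilinear_map_free_tensor_left:
  fixes X :: "'x set" and Y :: "'y set" and Z :: "'z set"
  shows "bilinear_map (free_space (X \<times> Y)) (free_space Z) (free_space (X \<times> Y \<times> Z))
    (free_tensor_left :: _ \<Rightarrow> _ \<Rightarrow> 'x \<times> 'y \<times> 'z \<Rightarrow>\<^sub>0 'k::field)"
proof -
  let ?f = "\<lambda>((p, q), r). basis_vec (p, q, r) :: 'x \<times> 'y \<times> 'z \<Rightarrow>\<^sub>0 'k"
  have "linear_map (free_space ((X \<times> Y) \<times> Z)) (free_space (X \<times> Y \<times> Z))
    (linear_extension (free_space (X \<times> Y \<times> Z)) ?f)"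
    by (rule linear_map_linear_extension[OF is_vspace_free_space]) auto
  then show ?thesis
    unfolding free_tensor_left_def linear_extension_free_space_cong[of UNIV ?f "X \<times> Y \<times> Z"]
    by (rule linear_map_bilinear_map[OF bilinear_map_free_tensor])
qed

lemma tensor_product_free_tensor_left:
  "tensor_product (free_space (X \<times> Y)) (free_space Z) (free_space (X \<times> Y \<times> Z)) free_tensor_left"
proof (rule tensor_product_free_space[where \<phi> = "\<lambda>((p, q), r). (p, q, r)"])
  show "bij_betw (\<lambda>((p, q), r). (p, q, r)) ((X \<times> Y) \<times> Z) (X \<times> Y \<times> Z)"
    by (rule bij_betw_byWitness[where f' = "\<lambda>(p, q, r). ((p, q), r)"]) auto
qed (auto simp: bilinear_map_free_tensor_left free_tensor_left_basis_vec)

text \<open>Reassociating triples is injective, so at most one term of the extension contributes to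
  a given coefficient.\<close>

lemma lookup_free_tensor_left:
  "Poly_Mapping.lookup (free_tensor_left x z) (p, q, r) =
    Poly_Mapping.lookup x (p, q) * Poly_Mapping.lookup z r"
proof -
  have "Poly_Mapping.lookup (free_tensor_left x z) (p, q, r) =
    (\<Sum>k\<in>Poly_Mapping.keys (free_tensor x z).
      if k = ((p, q), r) then Poly_Mapping.lookup (free_tensor x z) k else 0)"
    unfolding free_tensor_left_def linear_extension_def lookup_sum lookup_scl_free_space
    by (rule sum.cong) (auto simp: lookup_single when_def split: if_splits)
  then show ?thesis
    by (simp add: in_keys_iff flip: lookup_free_tensor)
qed

lemma free_tensor_left_assoc:
  "free_tensor_left (free_tensor a b) c = free_tensor a (free_tensor b c)"
  by (rule poly_mapping_eqI) (auto simp: lookup_free_tensor lookup_free_tensor_left)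

section \<open>Walks and their segments\<close>

lemma Vertex_in_paths [simp]: "Vertex v \<in> paths Q \<longleftrightarrow> v \<in> verts Q"
  and Arrows_in_paths [simp]: "Arrows es \<in> paths Q \<longleftrightarrow>
    es \<noteq> [] \<and> set es \<subseteq> arcs Q \<and> successively (\<lambda>e f. head Q e = tail Q f) es"
  by (auto simp: paths_def)

text \<open>
  A path of length \<open>n\<close> is described by its vertices \<open>v 0, \<dots>, v n\<close> and its arrows
  \<open>e 0, \<dots>, e (n - 1)\<close>; the subpath from \<open>v i\<close> to \<open>v j\<close> is then uniform in \<open>i \<le> j\<close>, with trivial
  paths included.
\<close>

definition walk :: "('v, 'e) pre_digraph \<Rightarrow> nat \<Rightarrow> (nat \<Rightarrow> 'v) \<Rightarrow> (nat \<Rightarrow> 'e) \<Rightarrow> bool" where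
  "walk Q n v e \<longleftrightarrow> (\<forall>k\<le>n. v k \<in> verts Q) \<and>
     (\<forall>k<n. e k \<in> arcs Q \<and> tail Q (e k) = v k \<and> head Q (e k) = v (Suc k))"

definition segment :: "(nat \<Rightarrow> 'v) \<Rightarrow> (nat \<Rightarrow> 'e) \<Rightarrow> nat \<Rightarrow> nat \<Rightarrow> ('v, 'e) qpath" where
  "segment v e i j = (if i < j then Arrows (map e [i..<j]) else Vertex (v i))"

lemma segment_in_paths:
  assumes "walk Q n v e" "i \<le> j" "j \<le> n"
  shows "segment v e i j \<in> paths Q"
proof -
  have "successively (\<lambda>e f. head Q e = tail Q f) (map e [i..<j])"
    using assms by (auto simp: successively_conv_nth walk_def)
  then show ?thesis
    using assms by (auto simp: segment_def walk_def)
qed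

lemma source_segment:
  "walk Q n v e \<Longrightarrow> i \<le> j \<Longrightarrow> j \<le> n \<Longrightarrow> source Q (segment v e i j) = v i"
  by (auto simp: segment_def walk_def hd_map)

lemma target_segment:
  "walk Q n v e \<Longrightarrow> i \<le> j \<Longrightarrow> j \<le> n \<Longrightarrow> target Q (segment v e i j) = v j"
  by (auto simp: segment_def walk_def last_map)

lemma concat_path_segment:
  assumes "i \<le> j" "j \<le> k"
  shows "concat_path (segment v e i j) (segment v e j k) = segment v e i k"
proof -
  have "[i..<j] @ [j..<k] = [i..<k]"
    using assms upt_add_eq_append[of i j "k - j"] by simp
  then show ?thesis
    using assms by (auto simp: segment_def simp flip: map_append)
qed

text \<open>A nontrivial path visits the tails of its arrows and then the head of the last one;
  well-formedness puts all of these into \<open>verts Q\<close>.\<close>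

lemma path_obtains_walk:
  assumes "wf_digraph Q" "p \<in> paths Q"
  obtains n v e where "walk Q n v e" "p = segment v e 0 n"
proof (cases p)
  case (Vertex u)
  then show ?thesis
    using assms(2) by (intro that[of 0 "\<lambda>_. u"]) (auto simp: walk_def segment_def)
next
  case (Arrows es)
  interpret wf_digraph Q by fact
  let ?n = "length es"
  \<comment> \<open>Index \<open>?n\<close> lies one past the last arrow, so the final vertex has to
    be read off as a head.\<close>
  let ?v = "\<lambda>k. if k < ?n then tail Q (es ! k) else head Q (last es)"
  have es: "es \<noteq> []" "set es \<subseteq> arcs Q" "successively (\<lambda>e f. head Q e = tail Q f) es"
    using assms(2) Arrows by auto
  have "head Q (es ! k) = ?v (Suc k)" if "k < ?n" for k
  proof (cases "Suc k < ?n")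
    case True
    then show ?thesis using es(3) by (simp add: successively_conv_nth)
  next
    case False
    then have "k = ?n - 1" using that by simp
    then show ?thesis using es(1) by (simp add: last_conv_nth)
  qed
  moreover have "es ! k \<in> arcs Q" if "k < ?n" for k
    using es(2) that nth_mem by blast
  moreover have "last es \<in> arcs Q" using es by auto
  ultimately have "walk Q ?n ?v ((!) es)" by (auto simp: walk_def)
  moreover have "p = segment ?v ((!) es) 0 ?n"
    using es(1) by (simp add: Arrows segment_def map_nth)
  ultimately show ?thesis by (rule that)
qed

section \<open>Concatenation of paths\<close>

lemma concat_path_in_paths:
  assumes "p \<in> paths Q" "q \<in> paths Q" "target Q p = source Q q"
  shows "concat_path p q \<in> paths Q"
  using assms by (cases p; cases q) (auto simp: successively_append_iff)

lemma concat_path_assoc: "concat_path (concat_path p q) r = concat_path p (concat_path q r)"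
  by (cases p; cases q; cases r) auto

lemma source_concat_path:
  "p \<in> paths Q \<Longrightarrow> target Q p = source Q q \<Longrightarrow> source Q (concat_path p q) = source Q p"
  by (cases p; cases q) auto

lemma target_concat_path:
  "q \<in> paths Q \<Longrightarrow> target Q p = source Q q \<Longrightarrow> target Q (concat_path p q) = target Q q"
  by (cases p; cases q) auto

text \<open>Two walks meeting in a vertex are glued into one, with \<open>p\<close> and
  \<open>q\<close> as adjacent segments. The derivation rule can then be read as splitting one index
  range at \<open>m\<close>.\<close>

lemma composable_obtains_walk:
  assumes Q: "wf_digraph Q" and p: "p \<in> paths Q" and q: "q \<in> paths Q"
    and pq: "target Q p = source Q q"
  obtains m n v e where "m \<le> n" "walk Q n v e" "p = segment v e 0 m" "q = segment v e m n"
proof -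
  obtain m v e where v: "walk Q m v e" "p = segment v e 0 m"
    by (rule path_obtains_walk[OF Q p])
  obtain n w f where w: "walk Q n w f" "q = segment w f 0 n"
    by (rule path_obtains_walk[OF Q q])
  have vw: "v m = w 0"
    using pq v w by (simp add: source_segment target_segment)
  let ?v = "\<lambda>k. if k < m then v k else w (k - m)" and ?e = "\<lambda>k. if k < m then e k else f (k - m)"
  have "head Q (?e k) = ?v (Suc k)" if "k < m + n" for k
  \<comment> \<open>The arrow before the junction has head \<open>v m\<close>, while
    \<open>?v\<close> takes the value \<open>w 0\<close> there; the two agree by
    \<open>vw\<close>.\<close>
  proof (cases "Suc k = m")
    case True
    then show ?thesis using v(1) vw by (auto simp: walk_def)
  next
    case False
    then show ?thesis using v(1) w(1) that by (auto simp: walk_def Suc_diff_le)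
  qed
  then have "walk Q (m + n) ?v ?e"
    using v(1) w(1) by (auto simp: walk_def)
  moreover have "p = segment ?v ?e 0 m"
    using v(2) vw by (auto simp: segment_def)
  moreover have "map ?e [m..<m + n] = map f [0..<n]"
    by (rule nth_equalityI) auto
  then have "q = segment ?v ?e m (m + n)"
    using w(2) by (simp add: segment_def)
  ultimately show ?thesis by (intro that[of m "m + n"]) simp_all
qed

section \<open>Comultiplication as a sum over removed arrows\<close>

text \<open>The separate formulas for a single arrow, for the two ends and for the interior are one
  sum over the position \<open>k\<close> of the removed arrow, counted from 0. An empty piece turns
  into the vertex at that end.\<close>

lemma comult_path_Arrows:
  assumes "es \<noteq> []"
  shows "comult_path Q (Arrows es) = (\<Sum>k<length es. basis_vec
    (if k = 0 then Vertex (tail Q (hd es)) else Arrows (take k es),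
     if Suc k = length es then Vertex (head Q (last es)) else Arrows (drop (Suc k) es)))"
    (is "_ = (\<Sum>k<_. ?b k)")
proof (cases es rule: list.exhaust)
  case (Cons e fs)
  show ?thesis
  proof (cases fs)
    case Nil
    then show ?thesis by (simp add: Cons free_tensor_basis_vec)
  next
    case (Cons f gs)
    with \<open>es = e # fs\<close> have es: "es = e # f # gs" by simp
    let ?n = "length es"
    \<comment> \<open>With at least two arrows the first and last positions are distinct, and an
      interior \<open>k\<close> is the summation index of the definition: \<open>k\<close> arrows
      precede the removed one.\<close>
    have "{..<?n} = insert 0 (insert (?n - 1) {1..?n - 2})"
      by (auto simp: es)
    then have "(\<Sum>k<?n. ?b k) = ?b 0 + (?b (?n - 1) + (\<Sum>k = 1..?n - 2. ?b k))"
      by (simp add: es)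
    also have "(\<Sum>k = 1..?n - 2. ?b k) =
      (\<Sum>k = 1..?n - 2. basis_vec (Arrows (take k es), Arrows (drop (k + 1) es)))"
      by (intro sum.cong) (auto simp: es)
    finally show ?thesis
      by (simp add: es free_tensor_basis_vec Let_def butlast_conv_take add.assoc)
  qed
qed (use assms in simp)

text \<open>\<open>segment\<close> yields a vertex on an empty index range, which absorbs the case
  distinctions at both ends. For \<open>i = j\<close> both sides are 0.\<close>

lemma comult_path_segment:
  assumes "walk Q n v e" "i \<le> j" "j \<le> n"
  shows "comult_path Q (segment v e i j) =
    (\<Sum>k\<in>{i..<j}. basis_vec (segment v e i k, segment v e (Suc k) j))"
proof (cases "i < j")
  case True
  have "comult_path Q (segment v e i j) = (\<Sum>k<j - i. basis_vec
    (segment v e i (i + k), segment v e (Suc (i + k)) j))"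
    unfolding segment_def using True
  proof (simp add: comult_path_Arrows, intro sum.cong refl)
    fix k assume "k \<in> {..<j - i}"
    then consider "j = Suc (i + k)" | "Suc (i + k) < j" by fastforce
    then show "basis_vec
      (if k = 0 then Vertex (tail Q (hd (map e [i..<j]))) else Arrows (take k (map e [i..<j])),
       if Suc k = j - i then Vertex (head Q (last (map e [i..<j])))
       else Arrows (drop (Suc k) (map e [i..<j]))) =
      basis_vec (if 0 < k then Arrows (map e [i..<i + k]) else Vertex (v i),
       if Suc (i + k) < j then Arrows (map e [Suc (i + k)..<j]) else Vertex (v (Suc (i + k))))"
      using assms True by cases (auto simp: take_map drop_map hd_map last_map walk_def)
  qed
  also have "\<dots> = (\<Sum>k\<in>{i..<j}. basis_vec (segment v e i k, segment v e (Suc k) j))"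
    by (rule sum.reindex_bij_witness[where i = "\<lambda>k. k - i" and j = "\<lambda>k. i + k"]) auto
  finally show ?thesis .
qed (simp add: segment_def)

section \<open>The path bialgebra\<close>

lemma free_tensor_0 [simp]: "free_tensor x 0 = 0" "free_tensor 0 y = 0"
  by (simp_all add: free_tensor_def)

lemma free_tensor_sum_right: "free_tensor x (\<Sum>i\<in>I. f i) = (\<Sum>i\<in>I. free_tensor x (f i))"
  by (rule poly_mapping_eqI) (auto simp: lookup_free_tensor lookup_sum sum_distrib_left)

lemma free_tensor_left_sum_left:
  "free_tensor_left (\<Sum>i\<in>I. f i) z = (\<Sum>i\<in>I. free_tensor_left (f i) z)"
  by (rule poly_mapping_eqI) (auto simp: lookup_free_tensor_left lookup_sum sum_distrib_right)

lemma tensor_powers_free_space: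
  "tensor_powers (free_space X) (free_space (X \<times> X)) free_tensor
    (free_space (X \<times> X \<times> X)) free_tensor_left free_tensor"
  by (simp add: tensor_powers_def tensor_product_free_tensor tensor_product_free_tensor_left
      free_tensor_left_assoc)

text \<open>A constant of its own keeps the composability test folded inside tensor expressions
  until it can be decided.\<close>

definition path_prod ::
  "('v, 'e) pre_digraph \<Rightarrow> ('v, 'e) qpath \<Rightarrow> ('v, 'e) qpath \<Rightarrow> ('v, 'e) qpath \<Rightarrow>\<^sub>0 'k::field" where
  "path_prod Q p q = (if target Q p = source Q q then basis_vec (concat_path p q) else 0)"

lemma path_mult_basis_vec: "path_mult Q (basis_vec (p, q)) = path_prod Q p q"
  by (simp add: path_mult_def path_prod_def
      linear_extension_basis_vec[OF is_vspaceD(1)[OF is_vspace_free_space]])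

lemma path_comult_basis_vec: "path_comult Q (basis_vec p) = comult_path Q p"
  by (simp add: path_comult_def
      linear_extension_basis_vec[OF is_vspaceD(1)[OF is_vspace_free_space]])

lemma path_prod_in_path_space:
  "p \<in> paths Q \<Longrightarrow> q \<in> paths Q \<Longrightarrow> path_prod Q p q \<in> vec (path_space Q)"
  by (auto simp: path_prod_def concat_path_in_paths is_vspaceD(4)[OF is_vspace_free_space])

lemma linear_map_path_mult:
  fixes Q :: "('v, 'e) pre_digraph"
  shows "linear_map (path_space2 Q) (path_space Q)
    (path_mult Q :: _ \<Rightarrow> ('v, 'e) qpath \<Rightarrow>\<^sub>0 'k::field)"
  unfolding path_mult_def
  by (rule linear_map_linear_extension[OF is_vspace_free_space])
    (auto simp: path_prod_in_path_space simp flip: path_prod_def)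

lemma linear_map_path_comult:
  fixes Q :: "('v, 'e) pre_digraph"
  assumes "wf_digraph Q"
  shows "linear_map (path_space Q) (path_space2 Q)
    (path_comult Q :: (('v, 'e) qpath \<Rightarrow>\<^sub>0 'k::field) \<Rightarrow> _)"
  unfolding path_comult_def
proof (rule linear_map_linear_extension[OF is_vspace_free_space])
  interpret V: vector_space "scl (path_space2 Q :: ('k, ('v, 'e) qpath \<times> ('v, 'e) qpath \<Rightarrow>\<^sub>0 'k) vspace)"
    by (rule is_vspaceD[OF is_vspace_free_space])
  fix p assume "p \<in> paths Q"
  then obtain n v e where "walk Q n v e" "p = segment v e 0 n"
    by (rule path_obtains_walk[OF assms])
  then show "comult_path Q p \<in> vec (path_space2 Q :: ('k, ('v, 'e) qpath \<times> ('v, 'e) qpath \<Rightarrow>\<^sub>0 'k) vspace)"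
    by (auto simp: comult_path_segment segment_in_paths
        intro!: V.subspace_sum is_vspaceD(3)[OF is_vspace_free_space])
qed

text \<open>The two compatibility axioms for the twist are immediate for \<open>id\<close>. The
  other three are checked on basis paths, those involving \<Delta> by writing paths as segments of
  walks.\<close>

theorem path_bialgebra:
  fixes Q :: "('v, 'e) pre_digraph"
  assumes Q: "wf_digraph Q"
  shows "eps_hom_bialgebra
    (path_space Q :: ('k::field, ('v, 'e) qpath \<Rightarrow>\<^sub>0 'k) vspace)
    (path_space2 Q) free_tensor (path_space3 Q) free_tensor_left free_tensor
    (path_mult Q) (path_comult Q) id"
proof -
  let ?A = "path_space Q :: ('k, ('v, 'e) qpath \<Rightarrow>\<^sub>0 'k) vspace"
  let ?A2 = "path_space2 Q :: ('k, ('v, 'e) qpath \<times> ('v, 'e) qpath \<Rightarrow>\<^sub>0 'k) vspace"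
  let ?A3 = "path_space3 Q :: ('k, ('v, 'e) qpath \<times> ('v, 'e) qpath \<times> ('v, 'e) qpath \<Rightarrow>\<^sub>0 'k) vspace"
  let ?\<mu> = "path_mult Q :: (('v, 'e) qpath \<times> ('v, 'e) qpath \<Rightarrow>\<^sub>0 'k) \<Rightarrow> _"
  let ?\<Delta> = "path_comult Q :: (('v, 'e) qpath \<Rightarrow>\<^sub>0 'k) \<Rightarrow> _"
  interpret P: tensor_powers ?A ?A2 free_tensor ?A3 free_tensor_left free_tensor
    by (rule tensor_powers_free_space)
  have A: "is_vspace ?A" and A2: "is_vspace ?A2" and A3: "is_vspace ?A3"
    by (rule is_vspace_free_space)+
  note lin = linear_map_path_mult[of Q, where ?'k = 'k] linear_map_path_comult[OF Q, where ?'k = 'k]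
  note sq = P.square and cl = P.cube_left and cr = P.cube_right
  let ?id\<mu> = "P.map_1_mult id ?\<mu>" and ?\<mu>id = "P.map_mult_1 ?\<mu> id"
    and ?id\<Delta> = "P.map_1_comult id ?\<Delta>" and ?\<Delta>id = "P.map_comult_1 ?\<Delta> id"
  have id\<mu>: "linear_map ?A3 ?A2 ?id\<mu>"
    unfolding P.map_1_mult_def by (rule linear_map_tensor_map[OF cr sq linear_map_id lin(1)])
  have \<mu>id: "linear_map ?A3 ?A2 ?\<mu>id"
    unfolding P.map_mult_1_def by (rule linear_map_tensor_map[OF cl sq lin(1) linear_map_id])
  have id\<Delta>: "linear_map ?A2 ?A3 ?id\<Delta>"
    unfolding P.map_1_comult_def by (rule linear_map_tensor_map[OF sq cr linear_map_id lin(2)])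
  have \<Delta>id: "linear_map ?A2 ?A3 ?\<Delta>id"
    unfolding P.map_comult_1_def by (rule linear_map_tensor_map[OF sq cl lin(2) linear_map_id])
  have idid: "linear_map ?A2 ?A2 (P.map_1_1 id id)"
    unfolding P.map_1_1_def by (rule linear_map_tensor_map[OF sq sq linear_map_id linear_map_id])
  have id\<mu>_basis: "?id\<mu> (basis_vec (p, q, r)) = free_tensor (basis_vec p) (path_prod Q q r)"
    if "p \<in> paths Q" "q \<in> paths Q" "r \<in> paths Q" for p q r
    using tensor_map_apply[OF cr sq linear_map_id lin(1), of "basis_vec p" "basis_vec (q, r)"] that
    by (simp add: P.map_1_mult_def free_tensor_basis_vec path_mult_basis_vec)
  have \<mu>id_basis: "?\<mu>id (basis_vec (p, q, r)) = free_tensor (path_prod Q p q) (basis_vec r)"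
    if "p \<in> paths Q" "q \<in> paths Q" "r \<in> paths Q" for p q r
    using tensor_map_apply[OF cl sq lin(1) linear_map_id, of "basis_vec (p, q)" "basis_vec r"] that
    by (simp add: P.map_mult_1_def free_tensor_left_basis_vec path_mult_basis_vec)
  have id\<Delta>_basis: "?id\<Delta> (basis_vec (p, q)) = free_tensor (basis_vec p) (comult_path Q q)"
    if "p \<in> paths Q" "q \<in> paths Q" for p q
    using tensor_map_apply[OF sq cr linear_map_id lin(2), of "basis_vec p" "basis_vec q"] that
    by (simp add: P.map_1_comult_def free_tensor_basis_vec path_comult_basis_vec)
  have \<Delta>id_basis: "?\<Delta>id (basis_vec (p, q)) = free_tensor_left (comult_path Q p) (basis_vec q)"
    if "p \<in> paths Q" "q \<in> paths Q" for p q
    using tensor_map_apply[OF sq cl lin(2) linear_map_id, of "basis_vec p" "basis_vec q"] that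
    by (simp add: P.map_comult_1_def free_tensor_basis_vec path_comult_basis_vec)
  \<comment> \<open>\<open>P.map_1_1 id id\<close> is a chosen map, so it is identified with the
    identity only on \<open>vec ?A2\<close>.\<close>
  have idid_apply: "P.map_1_1 id id x = x" if "x \<in> vec ?A2" for x
  proof -
    have "P.map_1_1 id id x = id x"
      using tensor_map_apply[OF sq sq linear_map_id linear_map_id]
      by (intro tensor_product_eqI[OF sq A2 idid linear_map_id _ that]) (simp add: P.map_1_1_def)
    then show ?thesis by simp
  qed
  have id\<Delta>_segment: "?id\<Delta> (basis_vec (p, segment v e i j)) =
      (\<Sum>k\<in>{i..<j}. basis_vec (p, segment v e i k, segment v e (Suc k) j))"
    if "p \<in> paths Q" "walk Q n v e" "i \<le> j" "j \<le> n" for p v e i j n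
    using that by (simp add: id\<Delta>_basis segment_in_paths comult_path_segment
        free_tensor_sum_right free_tensor_basis_vec)
  have \<Delta>id_segment: "?\<Delta>id (basis_vec (segment v e i j, q)) =
      (\<Sum>k\<in>{i..<j}. basis_vec (segment v e i k, segment v e (Suc k) j, q))"
    if "q \<in> paths Q" "walk Q n v e" "i \<le> j" "j \<le> n" for q v e i j n
    using that by (simp add: \<Delta>id_basis segment_in_paths comult_path_segment
        free_tensor_left_sum_left free_tensor_left_basis_vec)
  have \<mu>id_id\<Delta>_segment: "?\<mu>id (?id\<Delta> (basis_vec (p, segment v e i j))) =
      (\<Sum>k\<in>{i..<j}. free_tensor (path_prod Q p (segment v e i k)) (basis_vec (segment v e (Suc k) j)))"
    if "p \<in> paths Q" "walk Q n v e" "i \<le> j" "j \<le> n" for p v e i j n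
    unfolding id\<Delta>_segment[OF that] using that
    by (subst linear_map_sum[OF A3 \<mu>id]) (auto simp: \<mu>id_basis segment_in_paths[OF that(2)])
  have id\<mu>_\<Delta>id_segment: "?id\<mu> (?\<Delta>id (basis_vec (segment v e i j, q))) =
      (\<Sum>k\<in>{i..<j}. free_tensor (basis_vec (segment v e i k)) (path_prod Q (segment v e (Suc k) j) q))"
    if "q \<in> paths Q" "walk Q n v e" "i \<le> j" "j \<le> n" for q v e i j n
    unfolding \<Delta>id_segment[OF that] using that
    by (subst linear_map_sum[OF A3 id\<mu>]) (auto simp: id\<mu>_basis segment_in_paths[OF that(2)])
  \<comment> \<open>Concatenation keeps the outer endpoints, so both sides test the same two
    junctions; if either fails to match, both are 0.\<close>
  have assoc: "?\<mu> (?id\<mu> (basis_vec (p, q, r))) = ?\<mu> (?\<mu>id (basis_vec (p, q, r)))"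
    if "p \<in> paths Q" "q \<in> paths Q" "r \<in> paths Q" for p q r
    using that
    by (auto simp: id\<mu>_basis \<mu>id_basis path_prod_def free_tensor_basis_vec path_mult_basis_vec
        source_concat_path target_concat_path concat_path_assoc linear_map_0[OF A2 lin(1)])
  have coassoc: "?id\<Delta> (?\<Delta> (basis_vec p)) = ?\<Delta>id (?\<Delta> (basis_vec p))" if p: "p \<in> paths Q" for p
  proof -
    obtain n v e where v: "walk Q n v e" and p_eq: "p = segment v e 0 n"
      by (rule path_obtains_walk[OF Q p])
    \<comment> \<open>Here \<open>k < l\<close> are the positions of the two removed arrows. One
      side removes \<open>k\<close> first, the other \<open>l\<close>.\<close>
    let ?b = "\<lambda>k l. basis_vec (segment v e 0 k, segment v e (Suc k) l, segment v e (Suc l) n) ::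
      ('v, 'e) qpath \<times> ('v, 'e) qpath \<times> ('v, 'e) qpath \<Rightarrow>\<^sub>0 'k"
    have \<Delta>p: "?\<Delta> (basis_vec p) = (\<Sum>k\<in>{0..<n}. basis_vec (segment v e 0 k, segment v e (Suc k) n))"
      using v by (simp add: p_eq path_comult_basis_vec comult_path_segment)
    have "?id\<Delta> (?\<Delta> (basis_vec p)) = (\<Sum>k\<in>{0..<n}. \<Sum>l\<in>{Suc k..<n}. ?b k l)"
      unfolding \<Delta>p using v
      by (subst linear_map_sum[OF A2 id\<Delta>]) (auto simp: segment_in_paths[OF v] id\<Delta>_segment[OF _ v])
    \<comment> \<open>The triangular range is written as a restriction of a square so that the order
      of summation can be exchanged.\<close>
    also have "\<dots> = (\<Sum>k\<in>{0..<n}. \<Sum>l | l \<in> {0..<n} \<and> k < l. ?b k l)"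
      by (intro sum.cong refl) auto
    also have "\<dots> = (\<Sum>l\<in>{0..<n}. \<Sum>k | k \<in> {0..<n} \<and> k < l. ?b k l)"
      by (rule sum.swap_restrict) auto
    also have "\<dots> = (\<Sum>l\<in>{0..<n}. \<Sum>k\<in>{0..<l}. ?b k l)"
      by (intro sum.cong refl) auto
    also have "\<dots> = ?\<Delta>id (?\<Delta> (basis_vec p))"
      unfolding \<Delta>p using v
      by (subst linear_map_sum[OF A2 \<Delta>id]) (auto simp: segment_in_paths[OF v] \<Delta>id_segment[OF _ v])
    finally show ?thesis .
  qed
  have derivation: "?\<Delta> (?\<mu> (basis_vec (p, q))) =
    ?\<mu>id (?id\<Delta> (basis_vec (p, q))) + ?id\<mu> (?\<Delta>id (basis_vec (p, q)))"
    if p: "p \<in> paths Q" and q: "q \<in> paths Q" for p q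
  proof (cases "target Q p = source Q q")
    case True
    then obtain m n v e where mn: "m \<le> n" and v: "walk Q n v e"
      and p_eq: "p = segment v e 0 m" and q_eq: "q = segment v e m n"
      by (rule composable_obtains_walk[OF Q p q])
    let ?b = "\<lambda>k. basis_vec (segment v e 0 k, segment v e (Suc k) n) ::
      ('v, 'e) qpath \<times> ('v, 'e) qpath \<Rightarrow>\<^sub>0 'k"
    have prod: "path_prod Q (segment v e i j) (segment v e j k) = basis_vec (segment v e i k)"
      if "i \<le> j" "j \<le> k" "k \<le> n" for i j k
      using that v by (simp add: path_prod_def source_segment target_segment concat_path_segment)
    \<comment> \<open>This term removes an arrow of \<open>q\<close> and joins \<open>p\<close> to
      the part before it, which accounts for the positions from \<open>m\<close> on in the composite
      path.\<close>
    have "?\<mu>id (?id\<Delta> (basis_vec (p, q))) = (\<Sum>k\<in>{m..<n}. ?b k)"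
      using p mn by (simp add: q_eq \<mu>id_id\<Delta>_segment[OF _ v])
        (simp add: p_eq prod free_tensor_basis_vec)
    moreover have "?id\<mu> (?\<Delta>id (basis_vec (p, q))) = (\<Sum>k\<in>{0..<m}. ?b k)"
      using q mn by (simp add: p_eq id\<mu>_\<Delta>id_segment[OF _ v])
        (simp add: q_eq prod free_tensor_basis_vec)
    moreover have "?\<Delta> (?\<mu> (basis_vec (p, q))) = (\<Sum>k\<in>{0..<n}. ?b k)"
      using mn v by (simp add: p_eq q_eq path_mult_basis_vec prod path_comult_basis_vec comult_path_segment)
    ultimately show ?thesis
      using sum.atLeastLessThan_concat[of 0 m n ?b] mn by (simp add: add.commute)
  next
    case False
    obtain m v e where v: "walk Q m v e" and p_eq: "p = segment v e 0 m"
      by (rule path_obtains_walk[OF Q p])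
    obtain n w f where w: "walk Q n w f" and q_eq: "q = segment w f 0 n"
      by (rule path_obtains_walk[OF Q q])
    \<comment> \<open>The first piece of a cut of \<open>q\<close> has the same source as
      \<open>q\<close>, so its product with \<open>p\<close> is 0 as well. The last piece of a cut
      of \<open>p\<close> behaves likewise with respect to its target.\<close>
    have "?\<mu>id (?id\<Delta> (basis_vec (p, q))) = 0"
      using p False w by (simp add: q_eq \<mu>id_id\<Delta>_segment[OF _ w] path_prod_def source_segment)
    moreover have "?id\<mu> (?\<Delta>id (basis_vec (p, q))) = 0"
      using q False v by (simp add: p_eq id\<mu>_\<Delta>id_segment[OF _ v] path_prod_def target_segment)
    moreover have "?\<Delta> (?\<mu> (basis_vec (p, q))) = 0"
      using False by (simp add: path_mult_basis_vec path_prod_def linear_map_0[OF A lin(2)])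
    ultimately show ?thesis by simp
  qed
  show ?thesis
  proof
    show "linear_map ?A2 ?A ?\<mu>" "linear_map ?A ?A2 ?\<Delta>" "linear_map ?A ?A id"
      by (rule lin linear_map_id)+
    show "(id \<circ> ?\<mu>) x = (?\<mu> \<circ> P.map_1_1 id id) x" if "x \<in> vec ?A2" for x
      by (simp add: idid_apply[OF that])
    show "(P.map_1_1 id id \<circ> ?\<Delta>) x = (?\<Delta> \<circ> id) x" if "x \<in> vec ?A" for x
      by (simp add: idid_apply[OF linear_mapD(1)[OF lin(2) that]])
    show "(?\<mu> \<circ> ?id\<mu>) x = (?\<mu> \<circ> ?\<mu>id) x" if "x \<in> vec ?A3" for x
      by (rule free_space_linear_map_eqI[OF A linear_map_comp[OF id\<mu> lin(1)]
            linear_map_comp[OF \<mu>id lin(1)] _ that])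
        (elim SigmaE, simp only: comp_apply assoc)
    show "(?id\<Delta> \<circ> ?\<Delta>) x = (?\<Delta>id \<circ> ?\<Delta>) x" if "x \<in> vec ?A" for x
      by (rule free_space_linear_map_eqI[OF A3 linear_map_comp[OF lin(2) id\<Delta>]
            linear_map_comp[OF lin(2) \<Delta>id] _ that])
        (simp only: comp_apply coassoc)
    show "(?\<Delta> \<circ> ?\<mu>) x = (?\<mu>id \<circ> ?id\<Delta>) x + (?id\<mu> \<circ> ?\<Delta>id) x" if "x \<in> vec ?A2" for x
      by (rule free_space_linear_map_eqI[OF A2 linear_map_comp[OF lin] linear_map_add[OF A2
            linear_map_comp[OF id\<Delta> \<mu>id] linear_map_comp[OF \<Delta>id id\<mu>]] _ that])
        (elim SigmaE, simp only: comp_apply derivation)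
  qed
qed

section \<open>Quiver morphisms\<close>

definition path_map :: "('v \<Rightarrow> 'w) \<Rightarrow> ('e \<Rightarrow> 'f) \<Rightarrow> ('v, 'e) qpath \<Rightarrow> ('w, 'f) qpath" where
  "path_map \<alpha>0 \<alpha>1 p = (case p of Vertex v \<Rightarrow> Vertex (\<alpha>0 v) | Arrows es \<Rightarrow> Arrows (map \<alpha>1 es))"

lemma path_map_segment: "path_map \<alpha>0 \<alpha>1 (segment v e i j) = segment (\<alpha>0 \<circ> v) (\<alpha>1 \<circ> e) i j"
  by (simp add: path_map_def segment_def)

lemma path_map_concat_path:
  "path_map \<alpha>0 \<alpha>1 (concat_path p q) = concat_path (path_map \<alpha>0 \<alpha>1 p) (path_map \<alpha>0 \<alpha>1 q)"
  by (cases p; cases q) (auto simp: path_map_def)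

lemma induced_map_basis_vec:
  "induced_map Q' \<alpha>0 \<alpha>1 (basis_vec p) = basis_vec (path_map \<alpha>0 \<alpha>1 p)"
  unfolding induced_map_def linear_extension_basis_vec[OF is_vspaceD(1)[OF is_vspace_free_space]]
  by (simp add: path_map_def split: qpath.split)

context
  fixes Q :: "('v, 'e) pre_digraph" and Q' :: "('w, 'f) pre_digraph" 
    and \<alpha>0 :: "'v \<Rightarrow> 'w" and \<alpha>1 :: "'e \<Rightarrow> 'f"
  assumes Q: "wf_digraph Q" and Q': "wf_digraph Q'" and morphism: "quiver_morphism Q Q' \<alpha>0 \<alpha>1"
begin

lemma walk_map: "walk Q n v e \<Longrightarrow> walk Q' n (\<alpha>0 \<circ> v) (\<alpha>1 \<circ> e)"
  using morphism by (auto simp: walk_def quiver_morphism_def)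

lemma path_map_in_paths:
  assumes "p \<in> paths Q"
  shows "path_map \<alpha>0 \<alpha>1 p \<in> paths Q'"
proof -
  obtain n v e where "walk Q n v e" "p = segment v e 0 n"
    by (rule path_obtains_walk[OF Q assms])
  then show ?thesis by (simp add: path_map_segment segment_in_paths[OF walk_map])
qed

text \<open>Membership in \<open>verts Q\<close> is recorded because \<open>\<alpha>0\<close> is
  assumed injective only on that set.\<close>

lemma
  assumes "p \<in> paths Q"
  shows source_in_verts: "source Q p \<in> verts Q"
    and target_in_verts: "target Q p \<in> verts Q"
    and source_path_map: "source Q' (path_map \<alpha>0 \<alpha>1 p) = \<alpha>0 (source Q p)"
    and target_path_map: "target Q' (path_map \<alpha>0 \<alpha>1 p) = \<alpha>0 (target Q p)"
proof -
  obtain n v e where v: "walk Q n v e" and p: "p = segment v e 0 n"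
    by (rule path_obtains_walk[OF Q assms])
  show "source Q p \<in> verts Q" "target Q p \<in> verts Q"
    using v by (simp_all add: p source_segment[OF v] target_segment[OF v] walk_def)
  show "source Q' (path_map \<alpha>0 \<alpha>1 p) = \<alpha>0 (source Q p)"
    "target Q' (path_map \<alpha>0 \<alpha>1 p) = \<alpha>0 (target Q p)"
    by (simp_all add: p path_map_segment source_segment[OF v] target_segment[OF v]
        source_segment[OF walk_map[OF v]] target_segment[OF walk_map[OF v]])
qed

lemma linear_map_induced_map:
  "linear_map (path_space Q) (path_space Q')
    (induced_map Q' \<alpha>0 \<alpha>1 :: _ \<Rightarrow> ('w, 'f) qpath \<Rightarrow>\<^sub>0 'k::field)"
  unfolding induced_map_def
proof (rule linear_map_linear_extension[OF is_vspace_free_space])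
  fix p assume "p \<in> paths Q"
  then show "(case p of Vertex v \<Rightarrow> basis_vec (Vertex (\<alpha>0 v)) | Arrows es \<Rightarrow> basis_vec (Arrows (map \<alpha>1 es)))
    \<in> vec (path_space Q' :: ('k, ('w, 'f) qpath \<Rightarrow>\<^sub>0 'k) vspace)"
    using path_map_in_paths by (fastforce simp: path_map_def split: qpath.split)
qed

text \<open>Injectivity of \<open>\<alpha>0\<close> is needed here: otherwise non-composable paths may become composable.\<close>

lemma induced_map_mult:
  fixes x :: "('v, 'e) qpath \<times> ('v, 'e) qpath \<Rightarrow>\<^sub>0 'k::field"
  assumes "x \<in> vec (path_space2 Q)"
  shows "induced_map Q' \<alpha>0 \<alpha>1 (path_mult Q x) =
    path_mult Q' (tensor_map (path_space Q) (path_space Q) (path_space2 Q) free_tensor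
      (path_space2 Q') free_tensor (induced_map Q' \<alpha>0 \<alpha>1) (induced_map Q' \<alpha>0 \<alpha>1) x)"
proof -
  let ?\<alpha> = "induced_map Q' \<alpha>0 \<alpha>1 :: (('v, 'e) qpath \<Rightarrow>\<^sub>0 'k) \<Rightarrow> _"
  let ?\<alpha>\<alpha> = "tensor_map (path_space Q) (path_space Q) (path_space2 Q) free_tensor
    (path_space2 Q') free_tensor ?\<alpha> ?\<alpha>"
  note \<alpha> = linear_map_induced_map[where ?'k = 'k]
  note \<alpha>\<alpha> = tensor_map[OF tensor_product_free_tensor tensor_product_free_tensor \<alpha> \<alpha>]
  have "(?\<alpha> \<circ> path_mult Q) x = (path_mult Q' \<circ> ?\<alpha>\<alpha>) x"
  proof (rule free_space_linear_map_eqI[OF is_vspace_free_space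
        linear_map_comp[OF linear_map_path_mult \<alpha>] linear_map_comp[OF \<alpha>\<alpha>(1) linear_map_path_mult] _ assms])
    fix pq assume "pq \<in> paths Q \<times> paths Q"
    then obtain p q where pq: "pq = (p, q)" and p: "p \<in> paths Q" and q: "q \<in> paths Q" by blast
    have "?\<alpha>\<alpha> (basis_vec pq) = basis_vec (path_map \<alpha>0 \<alpha>1 p, path_map \<alpha>0 \<alpha>1 q)"
      using \<alpha>\<alpha>(2)[of "basis_vec p" "basis_vec q"] p q
      by (simp add: pq free_tensor_basis_vec induced_map_basis_vec)
    moreover have "target Q' (path_map \<alpha>0 \<alpha>1 p) = source Q' (path_map \<alpha>0 \<alpha>1 q) \<longleftrightarrow> target Q p = source Q q"
      using morphism source_in_verts[OF q] target_in_verts[OF p]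
      by (auto simp: source_path_map[OF q] target_path_map[OF p] quiver_morphism_def inj_on_def)
    ultimately show "(?\<alpha> \<circ> path_mult Q) (basis_vec pq) = (path_mult Q' \<circ> ?\<alpha>\<alpha>) (basis_vec pq)"
      by (simp add: pq path_mult_basis_vec path_prod_def induced_map_basis_vec path_map_concat_path
          linear_map_0[OF is_vspace_free_space \<alpha>])
  qed
  then show ?thesis by simp
qed

text \<open>A morphism carries a walk to a walk of the same length, so the cuts of a path and of its
  image correspond position by position.\<close>

lemma induced_map_comult:
  fixes x :: "('v, 'e) qpath \<Rightarrow>\<^sub>0 'k::field"
  assumes "x \<in> vec (path_space Q)"
  shows "tensor_map (path_space Q) (path_space Q) (path_space2 Q) free_tensor
      (path_space2 Q') free_tensor (induced_map Q' \<alpha>0 \<alpha>1) (induced_map Q' \<alpha>0 \<alpha>1) (path_comult Q x) =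
    path_comult Q' (induced_map Q' \<alpha>0 \<alpha>1 x)"
proof -
  let ?\<alpha> = "induced_map Q' \<alpha>0 \<alpha>1 :: (('v, 'e) qpath \<Rightarrow>\<^sub>0 'k) \<Rightarrow> _"
  let ?\<alpha>\<alpha> = "tensor_map (path_space Q) (path_space Q) (path_space2 Q) free_tensor
    (path_space2 Q') free_tensor ?\<alpha> ?\<alpha>"
  note \<alpha> = linear_map_induced_map[where ?'k = 'k]
  note \<alpha>\<alpha> = tensor_map[OF tensor_product_free_tensor tensor_product_free_tensor \<alpha> \<alpha>]
  have \<alpha>\<alpha>_basis: "?\<alpha>\<alpha> (basis_vec (p, q)) = basis_vec (path_map \<alpha>0 \<alpha>1 p, path_map \<alpha>0 \<alpha>1 q)"
    if "p \<in> paths Q" "q \<in> paths Q" for p q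
    using \<alpha>\<alpha>(2)[of "basis_vec p" "basis_vec q"] that
    by (simp add: free_tensor_basis_vec induced_map_basis_vec)
  have "(?\<alpha>\<alpha> \<circ> path_comult Q) x = (path_comult Q' \<circ> ?\<alpha>) x"
  proof (rule free_space_linear_map_eqI[OF is_vspace_free_space
        linear_map_comp[OF linear_map_path_comult[OF Q] \<alpha>\<alpha>(1)]
        linear_map_comp[OF \<alpha> linear_map_path_comult[OF Q']] _ assms])
    fix p assume "p \<in> paths Q"
    then obtain n v e where v: "walk Q n v e" and p: "p = segment v e 0 n"
      by (rule path_obtains_walk[OF Q])
    show "(?\<alpha>\<alpha> \<circ> path_comult Q) (basis_vec p) = (path_comult Q' \<circ> ?\<alpha>) (basis_vec p)"
      using walk_map[OF v] linear_map_sum[OF is_vspace_free_space \<alpha>\<alpha>(1),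
          of "{0..<n}" "\<lambda>k. basis_vec (segment v e 0 k, segment v e (Suc k) n)"]
      by (simp add: p path_comult_basis_vec comult_path_segment[OF v] comult_path_segment[of Q']
          induced_map_basis_vec path_map_segment \<alpha>\<alpha>_basis segment_in_paths[OF v])
  qed
  then show ?thesis by simp
qed

end

theorem corollary2p14:
  fixes Q :: "('v, 'e) pre_digraph"
    and \<alpha>0 :: "'v \<Rightarrow> 'v" and \<alpha>1 :: "'e \<Rightarrow> 'e"
  assumes "wf_digraph Q"
    and "quiver_morphism Q Q \<alpha>0 \<alpha>1"
  shows "eps_hom_bialgebra
    (path_space Q :: ('k::field_char_0, ('v, 'e) qpath \<Rightarrow>\<^sub>0 'k) vspace)
    (path_space2 Q) free_tensor (path_space3 Q) free_tensor_left free_tensor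
    (induced_map Q \<alpha>0 \<alpha>1 \<circ> path_mult Q)
    (path_comult Q \<circ> induced_map Q \<alpha>0 \<alpha>1)
    (induced_map Q \<alpha>0 \<alpha>1)"
proof (rule eps_hom_bialgebra_twist)
  \<comment> \<open>Well-formedness is listed twice because \<open>Q\<close> is both the source and
    the target of the morphism.\<close>
  note \<alpha> = assms(1) assms
  let ?\<alpha> = "induced_map Q \<alpha>0 \<alpha>1 :: (('v, 'e) qpath \<Rightarrow>\<^sub>0 'k) \<Rightarrow> _"
  let ?\<alpha>\<alpha> = "tensor_map (path_space Q) (path_space Q) (path_space2 Q) free_tensor
    (path_space2 Q) free_tensor ?\<alpha> ?\<alpha>"
  show "eps_hom_bialgebra (path_space Q :: ('k, ('v, 'e) qpath \<Rightarrow>\<^sub>0 'k) vspace)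
    (path_space2 Q) free_tensor (path_space3 Q) free_tensor_left free_tensor
    (path_mult Q) (path_comult Q) id"
    by (rule path_bialgebra[OF assms(1)])
  show "linear_map (path_space Q) (path_space Q) ?\<alpha>"
    by (rule linear_map_induced_map[OF \<alpha>])
  show "?\<alpha> (path_mult Q x) = path_mult Q (?\<alpha>\<alpha> x)" if "x \<in> vec (path_space2 Q)" for x
    by (rule induced_map_mult[OF \<alpha> that])
  show "?\<alpha>\<alpha> (path_comult Q x) = path_comult Q (?\<alpha> x)" if "x \<in> vec (path_space Q)" for x
    by (rule induced_map_comult[OF \<alpha> that])
qed

end
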